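(* Let $d\ge2$. There is a constant $c$ depending only on $d$ such that the following holds. Let $C,D\in\mathcal{C}^d_*$ be closed convex cones in $\mathbb{R}^d$ with $\delta_a(C,D)\le 1$. Then $$d_{bL}(\Omega_k(C,\cdot),\Omega_k(D,\cdot))\le c\,\delta_a(C,D)^{1/2}$$ for all $k\in\{1,\dots,d-1\}$.
   Context: $\mathbb{R}^d$ carries its standard scalar product $\langle\cdot,\cdot\rangle$ and norm $\|\cdot\|$; $o$ is the origin; $\mathbb{S}^{d-1}$ is the unit sphere; $\omega_n=2\pi^{n/2}/\Gamma(n/2)$; $\gamma_d$ is the standard Gaussian measure on $\mathbb{R}^d$. $\mathcal{C}^d_*$ is the set of closed convex cones with apex $o$ in $\mathbb{R}^d$ of positive dimension (i.e. different from $\{o\}$). The dual cone of $C$ is $C^\circ=\{x\in\mathbb{R}^d:\langle x,y\rangle\le 0\text{ for all }y\in C\}$. $\Pi_C:\mathbb{R}^d\to C$ is the nearest-point map (metric projection) onto $C$. Angular distance: for $C\in\mathcal{C}^d_*$, $d_a(x,C)=\arccos(\|\Pi_C(x)\|/\|x\|)$ if $x\ne o$, and $d_a(o,C)=\pi/2$. For $\lambda\ge0$ put $C^a_\lambda=\{x\in\mathbb{R}^d:d_a(x,C)\le\lambda\}$. The angular Hausdorff distance of $C,D\in\mathcal{C}^d_*$ is $$\delta_a(C,D)=\min\{\lambda\ge0: C\setminus\{o\}\subseteq D^a_\lambda,\ D\setminus\{o\}\subseteq C^a_\lambda\}.$$ The biconic $\sigma$-algebra $\widehat{\mathcal{B}}(\mathbb{R}^d\times\mathbb{R}^d)$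 consists of the Borel sets $\eta\subseteq\mathbb{R}^d\times\mathbb{R}^d$ such that $(\lambda x,\mu y)\in\eta$ whenever $(x,y)\in\eta$ and $\lambda,\mu>0$. Conic support measures. For $0\le\lambda<\pi/2$ and $\eta\in\widehat{\mathcal{B}}(\mathbb{R}^d\times\mathbb{R}^d)$ let $$M^a_\lambda(C,\eta)=\{x\in\mathbb{R}^d: d_a(x,C)\le\lambda,\ (\Pi_C(x),\Pi_{C^\circ}(x))\in\eta\}.$$ For $C\in\mathcal{C}^d_*$ it is known (local Steiner formula) that there exist finite measures $\Omega_1(C,\cdot),\dots,\Omega_d(C,\cdot)$ on $\widehat{\mathcal{B}}(\mathbb{R}^d\times\mathbb{R}^d)$, uniquely determined by the requirement that $$\gamma_d(M^a_\lambda(C,\eta))=\sum_{k=1}^d g_k(\lambda)\,\Omega_k(C,\eta)\quad\text{for all }\eta\in\widehat{\mathcal{B}}(\mathbb{R}^d\times\mathbb{R}^d),\ 0\le\lambda<\pi/2,$$ where $g_k(\lambda)=\frac{\omega_k\omega_{d-k}}{\omega_d}\int_0^\lambda\cos^{k-1}\varphi\,\sin^{d-k-1}\varphi\,\mathrm{d}\varphi$ for $k=1,\dots,d-1$ and $g_d\equiv1$. These are the conic support measures of $C$. For $1\le k\le d-1$, $\Omega_k(C,\cdot)$ is concentrated on pairs $(x,y)$ with $x\ne o$ and $y\neq o$. Bounded Lipschitz distance. For $f:\mathbb{S}^{d-1}\times\mathbb{S}^{d-1}\to\mathbb{R}$ let $\|f\|_L=\sup_{a\ne b}|f(a)-f(b)|/\|a-b\|$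 (Euclidean norm of $\mathbb{R}^d\times\mathbb{R}^d$) and $\|f\|_\infty=\sup_a|f(a)|$; let $\mathcal{F}_{bL}$ be the set of all such $f$ with $\|f\|_L\le1$ and $\|f\|_\infty\le1$. The homogeneous extension of $f$ is $f_h(x,y)=f(x/\|x\|,y/\|y\|)$ for $x,y\in\mathbb{R}^d\setminus\{o\}$. For finite measures $\mu,\nu$ on $\widehat{\mathcal{B}}(\mathbb{R}^d\times\mathbb{R}^d)$ (concentrated on pairs of nonzero vectors), $$d_{bL}(\mu,\nu)=\sup\left\{\left|\int_{\mathbb{R}^d\times\mathbb{R}^d}f_h\,\mathrm{d}\mu-\int_{\mathbb{R}^d\times\mathbb{R}^d}f_h\,\mathrm{d}\nu\right|: f\in\mathcal{F}_{bL}\right\}.$$ *)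

theory Defs
  imports "HOL-Analysis.Analysis"
begin

text \<open>Ambient dimension is \<open>DIM('a)\<close> throughout; the apex of every cone is the origin.\<close>

definition convex_cones :: "'a::euclidean_space set set" where
  "convex_cones = {C. closed C \<and> convex_cone C \<and> C \<noteq> {0}}"

definition dual_cone :: "'a::euclidean_space set \<Rightarrow> 'a set" where
  "dual_cone C = {x. \<forall>y\<in>C. x \<bullet> y \<le> 0}"

definition angular_dist :: "'a::euclidean_space \<Rightarrow> 'a set \<Rightarrow> real" where
  "angular_dist x C =
     (if x = 0 then pi / 2 else arccos (norm (closest_point C x) / norm x))"

definition angular_nbhd :: "real \<Rightarrow> 'a::euclidean_space set \<Rightarrow> 'a set" where
  "angular_nbhd t C = {x. angular_dist x C \<le> t}"

definition angular_hausdorff_bounds :: "'a::euclidean_space set \<Rightarrow> 'a set \<Rightarrow> real set" where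
  "angular_hausdorff_bounds C D =
     {t. 0 \<le> t \<and> C - {0} \<subseteq> angular_nbhd t D \<and> D - {0} \<subseteq> angular_nbhd t C}"

definition angular_hausdorff :: "'a::euclidean_space set \<Rightarrow> 'a set \<Rightarrow> real" where
  "angular_hausdorff C D = Inf (angular_hausdorff_bounds C D)"

text \<open>The infimum is a minimum.\<close>

lemma angular_hausdorff_attained:
  assumes "C \<in> convex_cones" "D \<in> convex_cones"
  shows "angular_hausdorff C D \<in> angular_hausdorff_bounds C D"
    and "\<And>t. t \<in> angular_hausdorff_bounds C D \<Longrightarrow> angular_hausdorff C D \<le> t"
proof -
  let ?B = "angular_hausdorff_bounds C D"
  have le: "angular_dist x E \<le> pi" if E: "E \<in> convex_cones" for x and E :: "'a set"
  proof (cases "x = 0")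
    case False
    have E': "closed E" "convex E" "0 \<in> E"
      using E by (auto simp: convex_cones_def convex_cone_contains_0 convex_cone_def)
    have z: "closest_point E 0 = 0"
      using E' by (simp add: closest_point_self)
    have "norm (closest_point E x) \<le> norm x"
      using closest_point_lipschitz[of E x 0] E' z by (simp add: dist_norm) blast
    then have "norm (closest_point E x) / norm x \<le> 1"
      using False by (simp add: divide_simps)
    moreover have "- 1 \<le> norm (closest_point E x) / norm x"
      by (rule order_trans[of _ 0]) auto
    ultimately show ?thesis
      using False by (simp add: angular_dist_def arccos_ubound)
  qed (simp add: angular_dist_def)
  have ne: "pi \<in> ?B"
    using le assms by (auto simp: angular_hausdorff_bounds_def angular_nbhd_def)
  have bdd: "bdd_below ?B"
    by (rule bdd_belowI[of _ 0]) (simp add: angular_hausdorff_bounds_def)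
  have "?B = {0..} \<inter> (\<Inter>x\<in>C - {0}. {angular_dist x D..}) \<inter> (\<Inter>x\<in>D - {0}. {angular_dist x C..})"
    by (auto simp: angular_hausdorff_bounds_def angular_nbhd_def)
  then have "closed ?B"
    by (simp add: closed_INT closed_Int)
  then show "angular_hausdorff C D \<in> ?B"
    unfolding angular_hausdorff_def using closed_contains_Inf[of ?B] ne bdd by blast
  show "\<And>t. t \<in> ?B \<Longrightarrow> angular_hausdorff C D \<le> t"
    unfolding angular_hausdorff_def by (rule cInf_lower[OF _ bdd])
qed

definition biconic_sets :: "('a::euclidean_space \<times> 'a) set set" where
  "biconic_sets = {\<eta> \<in> sets borel.
     \<forall>x y. \<forall>r>0. \<forall>s>0. (x, y) \<in> \<eta> \<longrightarrow> (r *\<^sub>R x, s *\<^sub>R y) \<in> \<eta>}"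

lemma sigma_algebra_biconic_sets:
  "sigma_algebra UNIV (biconic_sets :: ('a::euclidean_space \<times> 'a) set set)"
proof (rule sigma_algebra_iff2[THEN iffD2], intro conjI ballI allI impI)
  fix \<eta> :: "('a \<times> 'a) set"
  assume "\<eta> \<in> biconic_sets"
  then have b: "\<eta> \<in> sets borel"
    and c: "\<And>x y r s. r > 0 \<Longrightarrow> s > 0 \<Longrightarrow> (x, y) \<in> \<eta> \<Longrightarrow> (r *\<^sub>R x, s *\<^sub>R y) \<in> \<eta>"
    unfolding biconic_sets_def by blast+
  have c': "(x, y) \<in> \<eta>" if "r > 0" "s > 0" "(r *\<^sub>R x, s *\<^sub>R y) \<in> \<eta>" for x y r s
    using c[of "inverse r" "inverse s", OF _ _ that(3)] that(1,2) by simp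
  have "UNIV - \<eta> \<in> sets borel"
    using sets.compl_sets[OF b] by simp
  moreover have "(r *\<^sub>R x, s *\<^sub>R y) \<in> UNIV - \<eta>"
    if "r > 0" "s > 0" "(x, y) \<in> UNIV - \<eta>" for x y r s
    using that c'[OF that(1,2)] by blast
  ultimately show "UNIV - \<eta> \<in> biconic_sets"
    unfolding biconic_sets_def by blast
next
  fix A :: "nat \<Rightarrow> ('a \<times> 'a) set"
  assume A: "range A \<subseteq> biconic_sets"
  have "range A \<subseteq> sets borel"
    using A unfolding biconic_sets_def by blast
  then have "(\<Union>i. A i) \<in> sets borel"
    by (rule sets.countable_UN)
  moreover have "(r *\<^sub>R x, s *\<^sub>R y) \<in> A i" if "r > 0" "s > 0" "(x, y) \<in> A i" for i x y r s
  proof -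
    have "A i \<in> biconic_sets" using A by blast
    then show ?thesis using that unfolding biconic_sets_def by blast
  qed
  ultimately show "(\<Union>i. A i) \<in> biconic_sets"
    unfolding biconic_sets_def by blast
qed (simp_all add: biconic_sets_def)

definition std_gaussian :: "'a::euclidean_space measure" where
  "std_gaussian = density lborel
     (\<lambda>x. ennreal ((2 * pi) powr (- real DIM('a) / 2) * exp (- (norm x)\<^sup>2 / 2)))"

definition sphere_area :: "nat \<Rightarrow> real" where
  "sphere_area n = 2 * pi powr (real n / 2) / Gamma (real n / 2)"

definition steiner_coeff :: "nat \<Rightarrow> nat \<Rightarrow> real \<Rightarrow> real" where
  "steiner_coeff d k t =
     (if k = d then 1
      else sphere_area k * sphere_area (d - k) / sphere_area d *
             integral {0..t} (\<lambda>\<phi>. cos \<phi> ^ (k - 1) * sin \<phi> ^ (d - k - 1)))"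

definition local_parallel_set ::
    "real \<Rightarrow> 'a::euclidean_space set \<Rightarrow> ('a \<times> 'a) set \<Rightarrow> 'a set" where
  "local_parallel_set t C \<eta> =
     {x. angular_dist x C \<le> t \<and> (closest_point C x, closest_point (dual_cone C) x) \<in> \<eta>}"

text \<open>
  \<open>conic_support_measures C \<Omega>\<close>: the family \<open>\<Omega> 1, \<dots>, \<Omega> d\<close> is the family of conic support
  measures of \<open>C\<close>. They are introduced by their defining property, the local Steiner formula, which
  determines them uniquely on the biconic sets; values of \<open>\<Omega>\<close> at other indices are irrelevant.
\<close>

definition conic_support_measures ::
    "'a::euclidean_space set \<Rightarrow> (nat \<Rightarrow> ('a \<times> 'a) measure) \<Rightarrow> bool" where
  "conic_support_measures C \<Omega> \<longleftrightarrow>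
     (\<forall>k\<in>{1..DIM('a)}. sets (\<Omega> k) = biconic_sets \<and> finite_measure (\<Omega> k)) \<and>
     (\<forall>\<eta>\<in>biconic_sets. \<forall>t. 0 \<le> t \<and> t < pi / 2 \<longrightarrow>
        measure std_gaussian (local_parallel_set t C \<eta>) =
          (\<Sum>k = 1..DIM('a). steiner_coeff DIM('a) k t * measure (\<Omega> k) \<eta>))"

text \<open>
  Functions on the product of spheres are represented by total functions, of which only the values
  on that product matter. The metric on the product type is the Euclidean one.
\<close>

definition bounded_lipschitz_functions :: "('a::euclidean_space \<times> 'a \<Rightarrow> real) set" where
  "bounded_lipschitz_functions =
     {f. 1-lipschitz_on (sphere 0 1 \<times> sphere 0 1) f \<and>
         (\<forall>a\<in>sphere 0 1 \<times> sphere 0 1. \<bar>f a\<bar> \<le> 1)}"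

text \<open>
  The homogeneous extension is only meaningful at pairs of nonzero vectors; it is set to 0 elsewhere,
  so that it is measurable on the whole space whatever \<open>f\<close> does off the spheres.
\<close>

definition homogeneous_ext ::
    "('a::euclidean_space \<times> 'a \<Rightarrow> real) \<Rightarrow> 'a \<times> 'a \<Rightarrow> real" where
  "homogeneous_ext f = (\<lambda>(x, y). if x = 0 \<or> y = 0 then 0 else f (x /\<^sub>R norm x, y /\<^sub>R norm y))"

text \<open>
  For finite measures the set below is bounded (by the sum of the total masses) and nonempty, so the
  real supremum is the genuine one.
\<close>

definition dist_bL ::
    "('a::euclidean_space \<times> 'a) measure \<Rightarrow> ('a \<times> 'a) measure \<Rightarrow> real" where
  "dist_bL \<mu> \<nu> = (SUP f\<in>bounded_lipschitz_functions.
     \<bar>integral\<^sup>L \<mu> (homogeneous_ext f) - integral\<^sup>L \<nu> (homogeneous_ext f)\<bar>)"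

end

theory Submission
  imports Defs "HOL-Probability.Distributions"
begin

text \<open>
  The defining Steiner formula expresses the Gaussian measure of the parallel sets of a cone as a
  combination of the support measures, with coefficients \<open>g\<^sub>1, \<dots>, g\<^sub>d\<close> that do not depend
  on the cone. Up to a nonzero constant factor, \<open>g\<^sub>k'(t) = cos\<^sup>d\<^sup>-\<^sup>2 t tan\<^sup>d\<^sup>-\<^sup>k\<^sup>-\<^sup>1 t\<close> for \<open>k < d\<close>, so the
  coefficient functions are linearly independent on every open subinterval of \<open>(0, \<pi>/2)\<close>
  (\<open>steiner_coeff_independent\<close>).
  Hence there are finitely many angles \<open>t\<close> and weights \<open>w\<^sub>t\<close>, the same for all cones, with
  \<open>\<Sum>\<^sub>t w\<^sub>t g\<^sub>i(t) = \<delta>\<^sub>i\<^sub>k\<close> (\<open>steiner_dual_weights\<close>). Consequently the integral of a biconic function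
  \<open>h\<close> against \<open>\<Omega>\<^sub>k(C, \<cdot>)\<close> is the sum over \<open>t\<close> of \<open>w\<^sub>t\<close> times the Gaussian integral of
  \<open>x \<mapsto> h(\<Pi>\<^sub>C x, \<Pi>\<^sub>C\<^sub>\<degree> x)\<close> over the parallel set of \<open>C\<close> at angle \<open>t\<close>
  (\<open>integral_support_measure\<close>). It remains to compare such Gaussian integrals for two cones
  \<open>C\<close> and \<open>D\<close> at angular distance \<open>\<delta>\<close>. Two effects contribute.

  The integrands differ. The obtuse angle property of projections gives
  \<open>\<parallel>\<Pi>\<^sub>C x - \<Pi>\<^sub>D x\<parallel>\<^sup>2 \<le> 2 \<delta> \<parallel>x\<parallel>\<^sup>2\<close> (\<open>norm_diff_closest_points_le\<close>); this is where the exponent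
  \<open>1/2\<close> comes from. By Moreau's decomposition \<open>x = \<Pi>\<^sub>C x + \<Pi>\<^sub>C\<^sub>\<degree> x\<close> the same bound holds for
  the dual cones. A homogeneous extension \<open>f\<^sub>h\<close> normalizes both projections, and it is
  Lipschitz only away from their zeros. This is harmless: as \<open>g\<^sub>d\<close> is constant, the weights for
  \<open>k < d\<close> have sum zero, so the inner parallel set at angle \<open>1/4\<close> may be subtracted from all the
  domains of integration. On the remaining shells, both projections are at least a fixed multiple of
  \<open>\<parallel>x\<parallel>\<close> in length.

  The domains differ. By the triangle inequality for angles, the parallel set of \<open>C\<close> at angle
  \<open>t\<close> lies in that of \<open>D\<close> at angle \<open>t + \<delta>\<close> (\<open>angular_nbhd_subset\<close>). The Steiner formula shows that
  the Gaussian measure of a parallel set is a Lipschitz function of the angle, with a constant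
  depending only on the dimension (\<open>measure_angular_nbhd_Lipschitz\<close>), since the total masses of the
  support measures are bounded through the same inversion. So the symmetric difference has measure
  of order \<open>\<delta> \<le> \<delta>\<^sup>1\<^sup>/\<^sup>2\<close>. Taking all angles \<open>t \<le> 1/2\<close> ensures \<open>t + \<delta> \<le> 3/2 < \<pi>/2\<close>, so that the
  Steiner formula is available for the enlarged sets.
\<close>

section \<open>Metric projections onto closed convex cones\<close>

lemma convex_cones_D:
  assumes "C \<in> convex_cones"
  shows "closed C" "convex C" "0 \<in> C" "C \<noteq> {}" "\<And>x r. x \<in> C \<Longrightarrow> 0 \<le> r \<Longrightarrow> r *\<^sub>R x \<in> C"
  using assms
  by (auto simp: convex_cones_def convex_cone_contains_0 convex_cone_def conic_def)

lemma closest_point_cone: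
  assumes C: "C \<in> convex_cones"
  shows "closest_point C x \<in> C"
    and "\<And>y. y \<in> C \<Longrightarrow> (x - closest_point C x) \<bullet> y \<le> 0"
    and "(x - closest_point C x) \<bullet> closest_point C x = 0"
proof -
  note cone = convex_cones_D[OF C]
  let ?p = "closest_point C x"
  show p: "?p \<in> C"
    by (rule closest_point_in_set[OF cone(1,4)])
  have obtuse: "(x - ?p) \<bullet> (y - ?p) \<le> 0" if "y \<in> C" for y
    by (rule closest_point_dot[OF cone(2,1) that])
  \<comment> \<open>The ray through \<open>?p\<close> lies in the cone and extends to both sides of \<open>?p\<close>.\<close>
  have "(x - ?p) \<bullet> (2 *\<^sub>R ?p - ?p) \<le> 0" "(x - ?p) \<bullet> (0 - ?p) \<le> 0"
    using obtuse[OF cone(5)[OF p, of 2]] obtuse[OF cone(3)] by simp_all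
  then show orth: "(x - ?p) \<bullet> ?p = 0"
    by (simp add: scaleR_2)
  show "(x - ?p) \<bullet> y \<le> 0" if "y \<in> C" for y
    using obtuse[OF that] orth by (simp add: inner_diff_right)
qed

lemma norm_closest_point_cone:
  assumes C: "C \<in> convex_cones"
  shows "(norm x)\<^sup>2 = (norm (closest_point C x))\<^sup>2 + (norm (x - closest_point C x))\<^sup>2"
    and "norm (closest_point C x) \<le> norm x" and "norm (x - closest_point C x) \<le> norm x"
    and "x \<bullet> closest_point C x = (norm (closest_point C x))\<^sup>2"
proof -
  let ?p = "closest_point C x"
  show *: "x \<bullet> ?p = (norm ?p)\<^sup>2"
    using closest_point_cone(3)[OF C, of x] by (simp add: inner_diff_left power2_norm_eq_inner)
  show py: "(norm x)\<^sup>2 = (norm ?p)\<^sup>2 + (norm (x - ?p))\<^sup>2"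
    using * by (simp add: power2_norm_eq_inner inner_diff_left inner_diff_right inner_commute)
  show "norm ?p \<le> norm x" "norm (x - ?p) \<le> norm x"
    by (rule power2_le_imp_le; simp add: py)+
qed

text \<open>
  Moreau's decomposition: the residual \<open>x - \<Pi>\<^sub>C x\<close> lies in the dual cone, and any
  \<open>z\<close> there has \<open>\<langle>z, \<Pi>\<^sub>C x\<rangle> \<le> 0\<close>, so Cauchy--Schwarz applied to \<open>\<langle>x - z, \<Pi>\<^sub>C x\<rangle>\<close> shows that
  \<open>z\<close> is at least as far from \<open>x\<close>.
\<close>

lemma closest_point_dual_cone:
  assumes C: "C \<in> convex_cones"
  shows "closest_point (dual_cone C) x = x - closest_point C x"
proof (rule sym, rule closest_point_unique)
  let ?p = "closest_point C x"
  have eq: "dual_cone C = (\<Inter>y\<in>C. {x. y \<bullet> x \<le> 0})"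
    by (auto simp: dual_cone_def inner_commute)
  show "convex (dual_cone C)" unfolding eq by (intro convex_INT convex_halfspace_le)
  show "closed (dual_cone C)" unfolding eq by (intro closed_INT ballI closed_halfspace_le)
  show "x - ?p \<in> dual_cone C"
    using closest_point_cone(2)[OF C] by (simp add: dual_cone_def)
  show "\<forall>z\<in>dual_cone C. dist x (x - ?p) \<le> dist x z"
  proof
    fix z assume "z \<in> dual_cone C"
    then have "z \<bullet> ?p \<le> 0"
      using closest_point_cone(1)[OF C] by (simp add: dual_cone_def)
    then have "norm ?p * norm ?p \<le> (x - z) \<bullet> ?p"
      using norm_closest_point_cone(4)[OF C, of x]
      by (simp add: inner_diff_left power2_eq_square)
    also have "\<dots> \<le> norm (x - z) * norm ?p"
      by (rule norm_cauchy_schwarz)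
    finally have "norm ?p \<le> norm (x - z)"
      by (cases "?p = 0") auto
    then show "dist x (x - ?p) \<le> dist x z"
      by (simp add: dist_norm)
  qed
qed

text \<open>
  This form of the condition is free of \<open>arccos\<close>. It yields measurability of the parallel sets and
  turns angular estimates into inequalities between norms.
\<close>

lemma angular_dist_le_iff:
  assumes C: "C \<in> convex_cones" and t: "0 \<le> t" "t < pi / 2"
  shows "angular_dist x C \<le> t \<longleftrightarrow> x \<noteq> 0 \<and> cos t * norm x \<le> norm (closest_point C x)"
proof (cases "x = 0")
  case False
  let ?r = "norm (closest_point C x) / norm x"
  have r: "0 \<le> ?r" "?r \<le> 1"
    using False norm_closest_point_cone(2)[OF C, of x] by (auto simp: divide_simps)
  then have r1: "- 1 \<le> ?r" by linarith
  have "arccos ?r \<le> t \<longleftrightarrow> cos t \<le> ?r"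
  proof
    assume "arccos ?r \<le> t"
    then have "cos t \<le> cos (arccos ?r)"
      using r r1 t by (intro cos_monotone_0_pi_le arccos_lbound) auto
    then show "cos t \<le> ?r" using r r1 by (simp add: cos_arccos)
  next
    assume "cos t \<le> ?r"
    then have "arccos ?r \<le> arccos (cos t)"
      using r by (intro arccos_le_arccos) auto
    then show "arccos ?r \<le> t" using t by (simp add: arccos_cos)
  qed
  then show ?thesis
    using False by (simp add: angular_dist_def pos_le_divide_eq)
qed (use t in \<open>simp add: angular_dist_def\<close>)

text \<open>
  The angular Hausdorff distance is attained, and \<open>1 < pi / 2\<close>, so the condition on angles can be
  stated without \<open>arccos\<close>, which also covers \<open>y = 0\<close>.
\<close>

lemma angular_hausdorff_closest_point:
  assumes C: "C \<in> convex_cones" and D: "D \<in> convex_cones"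
    and \<delta>: "angular_hausdorff C D \<le> 1"
  shows "0 \<le> angular_hausdorff C D"
    and "y \<in> C \<Longrightarrow> cos (angular_hausdorff C D) * norm y \<le> norm (closest_point D y)"
    and "y \<in> D \<Longrightarrow> cos (angular_hausdorff C D) * norm y \<le> norm (closest_point C y)"
proof -
  have b: "angular_hausdorff C D \<in> angular_hausdorff_bounds C D"
    by (rule angular_hausdorff_attained(1)[OF C D])
  show nonneg: "0 \<le> angular_hausdorff C D"
    using b by (simp add: angular_hausdorff_bounds_def)
  have lt: "angular_hausdorff C D < pi / 2"
    using \<delta> pi_gt3 by simp
  show "cos (angular_hausdorff C D) * norm y \<le> norm (closest_point D y)" if "y \<in> C"
    using b that angular_dist_le_iff[OF D nonneg lt, of y]
    by (cases "y = 0") (auto simp: angular_hausdorff_bounds_def angular_nbhd_def)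
  show "cos (angular_hausdorff C D) * norm y \<le> norm (closest_point C y)" if "y \<in> D"
    using b that angular_dist_le_iff[OF C nonneg lt, of y]
    by (cases "y = 0") (auto simp: angular_hausdorff_bounds_def angular_nbhd_def)
qed

text \<open>
  In the right triangle with vertices \<open>0\<close>, \<open>y\<close>, \<open>\<Pi>\<^sub>D y\<close> the angle at \<open>0\<close> is at most \<open>\<delta>\<close>, and
  \<open>sin \<delta> \<le> \<delta>\<close>.
\<close>

lemma norm_diff_closest_point_le:
  assumes D: "D \<in> convex_cones" and \<delta>: "0 \<le> \<delta>"
    and le: "cos \<delta> * norm y \<le> norm (closest_point D y)" and cos: "0 \<le> cos \<delta>"
  shows "norm (y - closest_point D y) \<le> \<delta> * norm y"
proof (rule power2_le_imp_le)
  have "(cos \<delta> * norm y)\<^sup>2 \<le> (norm (closest_point D y))\<^sup>2"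
    by (rule power_mono[OF le]) (use cos in simp)
  then have "(norm (y - closest_point D y))\<^sup>2 \<le> (norm y)\<^sup>2 - (cos \<delta> * norm y)\<^sup>2"
    using norm_closest_point_cone(1)[OF D, of y] by simp
  also have "\<dots> = (sin \<delta>)\<^sup>2 * (norm y)\<^sup>2"
    by (simp add: power_mult_distrib sin_squared_eq algebra_simps)
  also have "\<dots> \<le> \<delta>\<^sup>2 * (norm y)\<^sup>2"
  proof (rule mult_right_mono)
    show "(sin \<delta>)\<^sup>2 \<le> \<delta>\<^sup>2"
      using abs_sin_x_le_abs_x[of \<delta>] by (simp add: abs_le_square_iff)
  qed simp
  finally show "(norm (y - closest_point D y))\<^sup>2 \<le> (\<delta> * norm y)\<^sup>2"
    by (simp add: power_mult_distrib)
qed (use \<delta> in simp)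

text \<open>
  Let \<open>p = \<Pi>\<^sub>C x\<close> and \<open>q = \<Pi>\<^sub>D x\<close>. As the cones are close, there are \<open>p' \<in> D\<close> and \<open>q' \<in> C\<close> within
  \<open>\<delta> \<parallel>x\<parallel>\<close> of \<open>p\<close> and \<open>q\<close>. Now \<open>\<parallel>p - q\<parallel>\<^sup>2 = \<langle>x - p, q - p\<rangle> + \<langle>x - q, p - q\<rangle>\<close>. If the
  minuends \<open>q\<close> and \<open>p\<close> of the second factors are replaced by \<open>q'\<close> and \<open>p'\<close>, both products become
  nonpositive, and the error of the replacement is at most \<open>2 \<delta> \<parallel>x\<parallel>\<^sup>2\<close>.
\<close>

lemma norm_diff_closest_points_le:
  assumes C: "C \<in> convex_cones" and D: "D \<in> convex_cones"
    and \<delta>: "angular_hausdorff C D \<le> 1"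
  shows "norm (closest_point C x - closest_point D x) \<le> sqrt (2 * angular_hausdorff C D) * norm x"
proof -
  let ?\<delta> = "angular_hausdorff C D"
  let ?p = "closest_point C x" and ?q = "closest_point D x"
  let ?p' = "closest_point D ?p" and ?q' = "closest_point C ?q"
  note ah = angular_hausdorff_closest_point[OF C D \<delta>]
  have cos: "0 \<le> cos ?\<delta>"
    using ah(1) \<delta> pi_gt3 by (intro cos_ge_zero) auto
  have "norm (?p - ?p') \<le> ?\<delta> * norm ?p"
    by (rule norm_diff_closest_point_le[OF D ah(1) ah(2)[OF closest_point_cone(1)[OF C]] cos])
  also have "\<dots> \<le> ?\<delta> * norm x"
    by (rule mult_left_mono[OF norm_closest_point_cone(2)[OF C] ah(1)])
  finally have p': "norm (?p - ?p') \<le> ?\<delta> * norm x" .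
  have "norm (?q - ?q') \<le> ?\<delta> * norm ?q"
    by (rule norm_diff_closest_point_le[OF C ah(1) ah(3)[OF closest_point_cone(1)[OF D]] cos])
  also have "\<dots> \<le> ?\<delta> * norm x"
    by (rule mult_left_mono[OF norm_closest_point_cone(2)[OF D] ah(1)])
  finally have q': "norm (?q - ?q') \<le> ?\<delta> * norm x" .
  have "(x - ?p) \<bullet> (?q - ?q') \<le> norm (x - ?p) * norm (?q - ?q')"
    by (rule norm_cauchy_schwarz)
  also have "\<dots> \<le> norm x * (?\<delta> * norm x)"
    by (intro mult_mono norm_closest_point_cone(3)[OF C] q') auto
  finally have 1: "(x - ?p) \<bullet> (?q - ?q') \<le> norm x * (?\<delta> * norm x)" .
  have "(x - ?q) \<bullet> (?p - ?p') \<le> norm (x - ?q) * norm (?p - ?p')"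
    by (rule norm_cauchy_schwarz)
  also have "\<dots> \<le> norm x * (?\<delta> * norm x)"
    by (intro mult_mono norm_closest_point_cone(3)[OF D] p') auto
  finally have 2: "(x - ?q) \<bullet> (?p - ?p') \<le> norm x * (?\<delta> * norm x)" .
  have 3: "(x - ?p) \<bullet> ?q' \<le> 0" "(x - ?q) \<bullet> ?p' \<le> 0"
    using closest_point_cone(1,2)[OF C] closest_point_cone(1,2)[OF D] by blast+
  have "(norm (?p - ?q))\<^sup>2 = (x - ?p) \<bullet> (?q - ?p) + (x - ?q) \<bullet> (?p - ?q)"
    by (simp add: power2_norm_eq_inner inner_diff_left inner_diff_right inner_commute)
  also have "\<dots> = (x - ?p) \<bullet> (?q - ?q') + (x - ?p) \<bullet> ?q' - (x - ?p) \<bullet> ?p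
      + ((x - ?q) \<bullet> (?p - ?p') + (x - ?q) \<bullet> ?p' - (x - ?q) \<bullet> ?q)"
    by (simp add: inner_diff_right)
  also have "\<dots> \<le> 2 * ?\<delta> * (norm x)\<^sup>2"
    using 1 2 3 closest_point_cone(3)[OF C, of x] closest_point_cone(3)[OF D, of x]
    by (simp add: power2_eq_square algebra_simps)
  also have "\<dots> = (sqrt (2 * ?\<delta>) * norm x)\<^sup>2"
    using ah(1) by (simp add: power_mult_distrib)
  finally show ?thesis
    by (rule power2_le_imp_le) (use ah(1) in simp)
qed

text \<open>
  Project \<open>x\<close> to \<open>p \<in> C\<close> and \<open>p\<close> to \<open>q \<in> D\<close>, at angles \<open>\<alpha> \<le> t\<close> and \<open>\<beta> \<le> \<delta>\<close>. The triangle inequality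
  for angles, in the form \<open>\<langle>x, q\<rangle> \<ge> \<parallel>x\<parallel> \<parallel>q\<parallel> cos (\<alpha> + \<beta>)\<close>, follows by splitting both vectors into their
  components parallel and orthogonal to \<open>p\<close> and applying Cauchy--Schwarz to the orthogonal parts.
  Finally \<open>\<langle>x, q\<rangle> \<le> \<parallel>\<Pi>\<^sub>D x\<parallel> \<parallel>q\<parallel>\<close> for every \<open>q \<in> D\<close>.
\<close>

lemma angular_nbhd_subset:
  assumes C: "C \<in> convex_cones" and D: "D \<in> convex_cones"
    and near: "\<And>y. y \<in> C \<Longrightarrow> cos \<delta> * norm y \<le> norm (closest_point D y)"
    and t: "0 \<le> t" "t < pi / 2" and \<delta>: "0 \<le> \<delta>" "\<delta> < pi / 2" and sum: "t + \<delta> < pi / 2"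
  shows "angular_nbhd t C \<subseteq> angular_nbhd (t + \<delta>) D"
proof
  fix x assume "x \<in> angular_nbhd t C"
  then have x: "x \<noteq> 0" and xt: "cos t * norm x \<le> norm (closest_point C x)"
    using angular_dist_le_iff[OF C t] by (auto simp: angular_nbhd_def)
  define p where "p = closest_point C x"
  define q where "q = closest_point D p"
  define \<alpha> where "\<alpha> = arccos (norm p / norm x)"
  define \<beta> where "\<beta> = arccos (norm q / norm p)"
  have cost: "0 < cos t" "0 < cos \<delta>"
    using t \<delta> by (intro cos_gt_zero_pi; simp)+
  have "0 < cos t * norm x" using cost x by simp
  with xt have p: "p \<noteq> 0" by (auto simp: p_def)
  have pC: "p \<in> C" unfolding p_def by (rule closest_point_cone(1)[OF C])
  have pq: "cos \<delta> * norm p \<le> norm q" unfolding q_def by (rule near[OF pC])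
  moreover have "0 < cos \<delta> * norm p" using cost p by simp
  ultimately have q: "q \<noteq> 0" by auto
  have r: "norm p / norm x \<le> 1" "norm q / norm p \<le> 1"
    using norm_closest_point_cone(2)[OF C, of x] norm_closest_point_cone(2)[OF D, of p] x p
    by (auto simp: p_def q_def divide_simps)
  have r0: "-1 \<le> norm p / norm x" "-1 \<le> norm q / norm p"
    by (rule order_trans[of _ 0]; simp)+
  have cosa: "norm p = cos \<alpha> * norm x" and cosb: "norm q = cos \<beta> * norm p"
    using r r0 x p by (auto simp: \<alpha>_def \<beta>_def cos_arccos)
  have ab0: "0 \<le> \<alpha>" "0 \<le> \<beta>"
    using r r0 by (auto simp: \<alpha>_def \<beta>_def intro: arccos_lbound)
  have at: "\<alpha> \<le> t"
    using angular_dist_le_iff[OF C t, of x] x xt by (simp add: angular_dist_def \<alpha>_def p_def)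
  have bd: "\<beta> \<le> \<delta>"
    using angular_dist_le_iff[OF D \<delta>, of p] p pq by (simp add: angular_dist_def \<beta>_def q_def)
  have sin0: "0 \<le> sin \<alpha>" "0 \<le> sin \<beta>"
    using ab0 at bd t \<delta> by (intro sin_ge_zero; simp)+
  have xp: "norm (x - p) = sin \<alpha> * norm x"
  proof (rule power2_eq_imp_eq)
    show "(norm (x - p))\<^sup>2 = (sin \<alpha> * norm x)\<^sup>2"
      using norm_closest_point_cone(1)[OF C, of x, folded p_def] cosa
      by (simp add: power_mult_distrib sin_squared_eq algebra_simps)
  qed (use sin0 in auto)
  \<comment> \<open>the component of \<open>q\<close> orthogonal to \<open>p\<close>, as \<open>\<langle>p, q\<rangle> = \<parallel>q\<parallel>\<^sup>2 = (cos \<beta>)\<^sup>2 \<parallel>p\<parallel>\<^sup>2\<close>\<close>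
  define w where "w = q - (cos \<beta>)\<^sup>2 *\<^sub>R p"
  have qp: "p \<bullet> q = (norm q)\<^sup>2"
    unfolding q_def by (rule norm_closest_point_cone(4)[OF D])
  have w: "norm w = sin \<beta> * norm q"
  proof (rule power2_eq_imp_eq)
    have "w \<bullet> w = q \<bullet> q - 2 * (cos \<beta>)\<^sup>2 * (p \<bullet> q) + (cos \<beta>)\<^sup>2 * ((cos \<beta>)\<^sup>2 * (p \<bullet> p))"
      by (simp add: w_def inner_diff_left inner_diff_right inner_commute)
    then have "(norm w)\<^sup>2 = (norm q)\<^sup>2 - 2 * (cos \<beta>)\<^sup>2 * (norm q)\<^sup>2 + (cos \<beta>)\<^sup>2 * ((cos \<beta>)\<^sup>2 * (norm p)\<^sup>2)"
      unfolding qp by (simp add: power2_norm_eq_inner)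
    also have "(cos \<beta>)\<^sup>2 * (norm p)\<^sup>2 = (norm q)\<^sup>2"
      by (simp add: cosb power_mult_distrib)
    finally show "(norm w)\<^sup>2 = (sin \<beta> * norm q)\<^sup>2"
      by (simp add: power_mult_distrib sin_squared_eq algebra_simps)
  qed (use sin0 in auto)
  have orth: "(x - p) \<bullet> p = 0"
    unfolding p_def by (rule closest_point_cone(3)[OF C])
  have "cos (\<alpha> + \<beta>) * norm x * norm q = (norm q)\<^sup>2 - norm (x - p) * norm w"
    unfolding xp w by (simp add: cos_add power2_eq_square cosa cosb algebra_simps)
  also have "\<dots> \<le> (norm q)\<^sup>2 + (x - p) \<bullet> w"
    using Cauchy_Schwarz_ineq2[of "x - p" w] by (auto simp: abs_le_iff)
  also have "\<dots> = x \<bullet> q"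
    using orth qp by (simp add: w_def inner_diff_left inner_diff_right)
  also have "\<dots> \<le> closest_point D x \<bullet> q"
    using closest_point_cone(2)[OF D, of q x] closest_point_cone(1)[OF D, of p]
    by (simp add: q_def inner_diff_left)
  also have "\<dots> \<le> norm (closest_point D x) * norm q"
    by (rule norm_cauchy_schwarz)
  finally have "cos (\<alpha> + \<beta>) * norm x \<le> norm (closest_point D x)"
    using q by simp
  moreover have "cos (t + \<delta>) * norm x \<le> cos (\<alpha> + \<beta>) * norm x"
    using ab0 at bd sum pi_gt3 by (intro mult_right_mono cos_monotone_0_pi_le) auto
  ultimately have "cos (t + \<delta>) * norm x \<le> norm (closest_point D x)"
    by linarith
  then show "x \<in> angular_nbhd (t + \<delta>) D"
    using angular_dist_le_iff[OF D _ sum, of x] t \<delta> x by (simp add: angular_nbhd_def)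
qed

section \<open>Gaussian measure\<close>

text \<open>
  The density is the product over the coordinates of one-dimensional standard normal densities.
\<close>

lemma prob_space_std_gaussian: "prob_space (std_gaussian :: 'a::euclidean_space measure)"
proof
  have density: "ennreal ((2 * pi) powr (- real DIM('a) / 2) * exp (- (norm x)\<^sup>2 / 2))
      = (\<Prod>b\<in>Basis. ennreal (std_normal_density (x \<bullet> b)))" for x :: 'a
  proof -
    have "(\<Prod>b\<in>Basis. std_normal_density (x \<bullet> b))
        = (1 / sqrt (2 * pi)) ^ DIM('a) * exp (- (\<Sum>b\<in>Basis. (x \<bullet> b)\<^sup>2 / 2))"
      by (simp add: std_normal_density_def prod.distrib exp_sum prod_dividef power_divide flip: sum_negf)
    also have "(\<Sum>b\<in>Basis. (x \<bullet> b)\<^sup>2 / 2) = (norm x)\<^sup>2 / 2"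
      unfolding power2_norm_eq_inner euclidean_inner[of x x] sum_divide_distrib
      by (simp add: power2_eq_square)
    also have "(1 / sqrt (2 * pi)) ^ DIM('a) = (2 * pi) powr (- real DIM('a) / 2)"
      by (simp add: powr_minus powr_half_sqrt [symmetric] power_divide powr_realpow[symmetric]
          powr_powr field_simps)
    finally show ?thesis
      by (simp add: prod_ennreal)
  qed
  have "emeasure (std_gaussian :: 'a measure) UNIV
      = (\<integral>\<^sup>+x. (\<Prod>b\<in>Basis. ennreal (std_normal_density (x \<bullet> b))) \<partial>(lborel :: 'a measure))"
    unfolding std_gaussian_def density by (subst emeasure_density) auto
  also have "\<dots> = (\<Prod>b\<in>(Basis :: 'a set). (\<integral>\<^sup>+x. ennreal (std_normal_density x) \<partial>lborel))"
    by (rule nn_integral_lborel_prod) auto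
  also have "(\<integral>\<^sup>+x. ennreal (std_normal_density x) \<partial>lborel) = 1"
    by (simp add: nn_integral_eq_integral)
  finally show "emeasure (std_gaussian :: 'a measure) (space std_gaussian) = 1"
    by (simp add: std_gaussian_def)
qed

lemma sets_std_gaussian [simp, measurable_cong]: "sets std_gaussian = sets borel"
  by (simp add: std_gaussian_def)

lemma space_std_gaussian [simp]: "space std_gaussian = UNIV"
  by (simp add: std_gaussian_def)

section \<open>Integrals against linear combinations of measures\<close>

text \<open>
  The weights may be negative, so the right-hand side is not an integral against a measure. For simple
  functions the identity is a finite computation, and dominated convergence, applied to each of the
  finitely many measures, extends it to bounded functions.
\<close>

lemma integral_eq_sum_integrals:
  fixes h :: "'a \<Rightarrow> real"
  assumes M: "finite_measure M" and N: "\<And>j. j \<in> J \<Longrightarrow> finite_measure (N j)"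
    and sets_N: "\<And>j. j \<in> J \<Longrightarrow> sets (N j) = sets M"
    and eq: "\<And>A. A \<in> sets M \<Longrightarrow> measure M A = (\<Sum>j\<in>J. a j * measure (N j) A)"
    and h: "h \<in> borel_measurable M" and bound: "\<And>x. x \<in> space M \<Longrightarrow> \<bar>h x\<bar> \<le> B"
  shows "integral\<^sup>L M h = (\<Sum>j\<in>J. a j * integral\<^sup>L (N j) h)"
proof -
  have space_N: "space (N j) = space M" if "j \<in> J" for j
    by (rule sets_eq_imp_space_eq[OF sets_N[OF that]])
  obtain s where s: "\<And>i::nat. simple_function M (s i)"
      "\<And>x. x \<in> space M \<Longrightarrow> (\<lambda>i. s i x) \<longlonglongrightarrow> h x"
      "\<And>i x. x \<in> space M \<Longrightarrow> norm (s i x) \<le> 2 * norm (h x)"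
    using borel_measurable_implies_sequence_metric[OF h, of 0] by simp metis
  have integral_s: "integral\<^sup>L K (s i) = (\<Sum>y\<in>s i ` space M. measure K {x\<in>space M. s i x = y} *\<^sub>R y)"
    if K: "finite_measure K" "sets K = sets M" for K i
  proof -
    interpret finite_measure K by (rule K)
    have sp: "space K = space M" by (rule sets_eq_imp_space_eq[OF K(2)])
    have "simple_function K (s i)"
      using s(1)[of i] K(2) sp by (simp add: simple_function_def)
    then have "Bochner_Integration.simple_bochner_integrable K (s i)"
      by (rule simple_bochner_integrable.intros[of K "s i"]) simp
    then show ?thesis
      by (simp add: simple_bochner_integrable_eq_integral[symmetric] simple_bochner_integral_def sp)
  qed
  have lim: "(\<lambda>i. integral\<^sup>L K (s i)) \<longlonglongrightarrow> integral\<^sup>L K h"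
    if K: "finite_measure K" "sets K = sets M" for K
  proof (rule integral_dominated_convergence[where w="\<lambda>_. 2 * B"])
    interpret finite_measure K by (rule K)
    have sp: "space K = space M" by (rule sets_eq_imp_space_eq[OF K(2)])
    show "integrable K (\<lambda>_. 2 * B)" by simp
    show "h \<in> borel_measurable K"
      using h by (simp add: measurable_cong_sets[OF K(2) refl])
    show "s i \<in> borel_measurable K" for i
      using borel_measurable_simple_function[OF s(1)[of i]]
      by (simp add: measurable_cong_sets[OF K(2) refl])
    show "AE x in K. (\<lambda>i. s i x) \<longlonglongrightarrow> h x"
      using s(2) by (intro AE_I2) (simp add: sp)
    show "AE x in K. norm (s i x) \<le> 2 * B" for i
    proof (rule AE_I2)
      fix x assume "x \<in> space K"
      then show "norm (s i x) \<le> 2 * B"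
        using s(3)[of x i] bound[of x] by (simp add: sp)
    qed
  qed
  have "integral\<^sup>L M (s i) = (\<Sum>j\<in>J. a j * integral\<^sup>L (N j) (s i))" for i
  proof -
    have meas: "{x\<in>space M. s i x = y} \<in> sets M" for y
      using simple_functionD(2)[OF s(1)[of i], of "{y}"] by (simp add: vimage_def Int_def conj_commute)
    have "integral\<^sup>L M (s i)
        = (\<Sum>y\<in>s i ` space M. (\<Sum>j\<in>J. a j * measure (N j) {x\<in>space M. s i x = y}) *\<^sub>R y)"
      using integral_s[OF M refl, of i] eq[OF meas] by simp
    also have "\<dots> = (\<Sum>j\<in>J. a j * (\<Sum>y\<in>s i ` space M. measure (N j) {x\<in>space M. s i x = y} *\<^sub>R y))"
      by (simp add: sum_distrib_left sum_distrib_right mult.assoc) (rule sum.swap)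
    finally show ?thesis
      by (simp add: integral_s[OF N sets_N])
  qed
  moreover have "(\<lambda>i. \<Sum>j\<in>J. a j * integral\<^sup>L (N j) (s i)) \<longlonglongrightarrow> (\<Sum>j\<in>J. a j * integral\<^sup>L (N j) h)"
    by (intro tendsto_sum tendsto_mult_left lim N sets_N)
  ultimately show ?thesis
    using LIMSEQ_unique lim[OF M refl] by simp
qed

section \<open>Inverting the Steiner formula\<close>

text \<open>
  Linear independence of the functions \<open>g i\<close> means that no nonzero vector is orthogonal to all the
  vectors \<open>v x = (g i x)\<^sub>i\<close> with \<open>x \<in> X\<close>, so these span the whole space. Writing a basis
  vector as a combination of them gives a combination of point evaluations that is dual to the
  functions. The index set is the basis of a Euclidean space, which makes orthogonality available.
\<close>

lemma dual_point_functionals: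
  fixes g :: "'a::euclidean_space \<Rightarrow> 'b \<Rightarrow> real"
  assumes indep: "\<And>b. (\<And>x. x \<in> X \<Longrightarrow> (\<Sum>i\<in>Basis. b i * g i x) = 0) \<Longrightarrow> \<forall>i\<in>Basis. b i = 0"
    and k: "k \<in> Basis"
  obtains T a where "finite T" "T \<subseteq> X"
    "\<And>i. i \<in> Basis \<Longrightarrow> (\<Sum>x\<in>T. a x * g i x) = (if i = k then 1 else 0)"
proof -
  define v :: "'b \<Rightarrow> 'a" where "v x = (\<Sum>i\<in>Basis. g i x *\<^sub>R i)" for x
  have inner_v: "v x \<bullet> i = g i x" if "i \<in> Basis" for i x
    using that by (simp add: v_def)
  have "span (v ` X) = UNIV"
  proof (rule ccontr)
    assume "span (v ` X) \<noteq> UNIV"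
    then obtain z where z: "z \<noteq> 0" "\<And>y. y \<in> span (v ` X) \<Longrightarrow> z \<bullet> y = 0"
      using span_not_UNIV_orthogonal[of "v ` X"] by auto
    have "(\<Sum>i\<in>Basis. (z \<bullet> i) * g i x) = 0" if "x \<in> X" for x
      using z(2)[OF span_base[OF imageI[OF that]]]
      by (simp add: v_def inner_sum_right mult.commute)
    then have "\<forall>i\<in>Basis. z \<bullet> i = 0" by (rule indep)
    then show False using z(1) by (simp add: euclidean_all_zero_iff)
  qed
  then have "k \<in> span (v ` X)" by simp
  then obtain S r where S: "finite S" "S \<subseteq> v ` X" "k = (\<Sum>w\<in>S. r w *\<^sub>R w)"
    unfolding span_explicit by blast
  obtain T where T: "T \<subseteq> X" "inj_on v T" "S = v ` T"
    using S(2) unfolding subset_image_inj by blast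
  have fin: "finite T" using S(1) T finite_imageD by blast
  have k_eq: "k = (\<Sum>x\<in>T. r (v x) *\<^sub>R v x)"
    unfolding S(3) T(3) using T(2) by (simp add: sum.reindex)
  show thesis
  proof (rule that[OF fin T(1), of "\<lambda>x. r (v x)"])
    fix i :: 'a assume i: "i \<in> Basis"
    have "(\<Sum>x\<in>T. r (v x) * g i x) = k \<bullet> i"
      by (subst k_eq) (simp add: inner_sum_left inner_v[OF i])
    then show "(\<Sum>x\<in>T. r (v x) * g i x) = (if i = k then 1 else 0)"
      using i k by (simp add: inner_Basis)
  qed
qed

lemma sphere_area_pos: "0 < n \<Longrightarrow> 0 < sphere_area n"
  by (simp add: sphere_area_def Gamma_real_pos)

lemma steiner_coeff_diff:
  assumes "k < d" "0 \<le> s" "s \<le> t"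
  shows "steiner_coeff d k t - steiner_coeff d k s
    = sphere_area k * sphere_area (d - k) / sphere_area d *
        integral {s..t} (\<lambda>\<phi>. cos \<phi> ^ (k - 1) * sin \<phi> ^ (d - k - 1))"
proof -
  have "integral {0..t} (\<lambda>\<phi>. cos \<phi> ^ (k - 1) * sin \<phi> ^ (d - k - 1))
      = integral {0..s} (\<lambda>\<phi>::real. cos \<phi> ^ (k - 1) * sin \<phi> ^ (d - k - 1))
      + integral {s..t} (\<lambda>\<phi>. cos \<phi> ^ (k - 1) * sin \<phi> ^ (d - k - 1))"
    by (rule Henstock_Kurzweil_Integration.integral_combine[OF assms(2,3), symmetric]) (intro integrable_continuous_real continuous_intros)
  then show ?thesis
    using assms(1) unfolding steiner_coeff_def by (auto simp: ring_distribs add_divide_distrib)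
qed

lemma steiner_coeff_Lipschitz:
  assumes "k < d" "0 \<le> s" "s \<le> t"
  shows "\<bar>steiner_coeff d k t - steiner_coeff d k s\<bar>
    \<le> \<bar>sphere_area k * sphere_area (d - k) / sphere_area d\<bar> * (t - s)"
proof -
  have "norm (integral {s..t} (\<lambda>\<phi>. cos \<phi> ^ (k - 1) * sin \<phi> ^ (d - k - 1))) \<le> 1 * (t - s)"
  proof (rule integral_bound)
    show "norm (cos \<phi> ^ (k - 1) * sin \<phi> ^ (d - k - 1)) \<le> 1" for \<phi> :: real
      by (simp add: abs_mult power_abs mult_le_one power_le_one)
  qed (use assms in \<open>auto intro!: continuous_intros\<close>)
  then show ?thesis
    unfolding steiner_coeff_diff[OF assms] abs_mult by (intro mult_left_mono) auto
qed

lemma steiner_coeff_derivative: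
  assumes k: "k < d" and t: "0 < t"
  shows "(steiner_coeff d k has_real_derivative
      sphere_area k * sphere_area (d - k) / sphere_area d * (cos t ^ (k - 1) * sin t ^ (d - k - 1)))
      (at t)"
proof -
  have "((\<lambda>u. integral {0..u} (\<lambda>\<phi>. cos \<phi> ^ (k - 1) * sin \<phi> ^ (d - k - 1))) has_real_derivative
      cos t ^ (k - 1) * sin t ^ (d - k - 1)) (at t within {0..t + 1})"
    using t by (intro integral_has_real_derivative continuous_intros) auto
  moreover have "at t within {0..t + 1} = at t"
    using t by (intro at_within_interior) auto
  ultimately have "((\<lambda>u. sphere_area k * sphere_area (d - k) / sphere_area d *
      integral {0..u} (\<lambda>\<phi>. cos \<phi> ^ (k - 1) * sin \<phi> ^ (d - k - 1))) has_real_derivative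
      sphere_area k * sphere_area (d - k) / sphere_area d * (cos t ^ (k - 1) * sin t ^ (d - k - 1)))
      (at t)"
    by (intro DERIV_cmult) auto
  moreover have "steiner_coeff d k = (\<lambda>u. sphere_area k * sphere_area (d - k) / sphere_area d *
      integral {0..u} (\<lambda>\<phi>. cos \<phi> ^ (k - 1) * sin \<phi> ^ (d - k - 1)))"
    using k by (auto simp: steiner_coeff_def)
  ultimately show ?thesis by simp
qed

text \<open>
  Differentiating a vanishing combination removes the constant \<open>g\<^sub>d\<close> and leaves, up to the
  factor \<open>cos\<^sup>d\<^sup>-\<^sup>2 t\<close>, a polynomial in \<open>tan t\<close> in which distinct indices contribute distinct degrees.
  It has infinitely many roots.
\<close>

lemma steiner_coeff_independent:
  assumes ab: "0 < a" "a < b" "b < pi / 2" and d: "0 < d"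
    and zero: "\<And>t. a < t \<Longrightarrow> t < b \<Longrightarrow> (\<Sum>k=1..d. c k * steiner_coeff d k t) = 0"
    and k: "k \<in> {1..d}"
  shows "c k = 0"
proof -
  let ?K = "\<lambda>k. sphere_area k * sphere_area (d - k) / sphere_area d"
  have split: "{1..d} = insert d {1..<d}" using d by auto
  have S: "(\<Sum>k=1..d. c k * steiner_coeff d k t) = c d + (\<Sum>k=1..<d. c k * steiner_coeff d k t)" for t
    unfolding split by (simp add: steiner_coeff_def)
  define p where "p = (\<Sum>k=1..<d. monom (c k * ?K k) (d - k - 1))"
  have root: "poly p (tan t) = 0" if t: "a < t" "t < b" for t
  proof -
    have cos: "0 < cos t" using t ab by (intro cos_gt_zero_pi) auto
    have "((\<lambda>t. c d + (\<Sum>k=1..<d. c k * steiner_coeff d k t)) has_real_derivative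
        0 + (\<Sum>k=1..<d. c k * (?K k * (cos t ^ (k - 1) * sin t ^ (d - k - 1))))) (at t)"
      using t ab by (intro DERIV_add DERIV_const DERIV_sum DERIV_cmult steiner_coeff_derivative) auto
    moreover have "((\<lambda>t. c d + (\<Sum>k=1..<d. c k * steiner_coeff d k t)) has_real_derivative 0) (at t)"
    proof (rule has_field_derivative_transform_within_open[OF DERIV_const[of 0], of "{a<..<b}"])
      show "0 = c d + (\<Sum>k=1..<d. c k * steiner_coeff d k x)" if "x \<in> {a<..<b}" for x
        using zero[of x] that S[of x] by (simp only: greaterThanLessThan_iff)
    qed (use t in auto)
    ultimately have "(\<Sum>k=1..<d. c k * (?K k * (cos t ^ (k - 1) * sin t ^ (d - k - 1)))) = 0"
      using DERIV_unique by fastforce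
    moreover have "(\<Sum>k=1..<d. c k * (?K k * (cos t ^ (k - 1) * sin t ^ (d - k - 1))))
        = cos t ^ (d - 2) * poly p (tan t)"
      unfolding p_def poly_sum sum_distrib_left
    proof (rule sum.cong[OF refl])
      fix k assume "k \<in> {1..<d}"
      then have "d - 2 = (k - 1) + (d - k - 1)" by auto
      then have "cos t ^ (d - 2) = cos t ^ (k - 1) * cos t ^ (d - k - 1)"
        by (simp add: power_add)
      then show "c k * (?K k * (cos t ^ (k - 1) * sin t ^ (d - k - 1)))
          = cos t ^ (d - 2) * poly (monom (c k * ?K k) (d - k - 1)) (tan t)"
        using cos by (simp add: poly_monom tan_def power_divide)
    qed
    ultimately show ?thesis using cos by simp
  qed
  have "infinite (tan ` {a<..<b})"
  proof
    assume "finite (tan ` {a<..<b})"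
    moreover have "inj_on tan {a<..<b}"
    proof (rule inj_onI)
      fix x y assume "x \<in> {a<..<b}" "y \<in> {a<..<b}" "tan x = tan y"
      then show "x = y"
        using ab tan_mono_lt_eq[of x y] tan_mono_lt_eq[of y x] by force
    qed
    ultimately show False
      using finite_imageD infinite_Ioo[OF ab(2)] by blast
  qed
  moreover have "tan ` {a<..<b} \<subseteq> {x. poly p x = 0}"
    using root by auto
  ultimately have "p = 0"
    using poly_roots_finite finite_subset by blast
  have lt: "c k = 0" if k: "k \<in> {1..<d}" for k
  proof -
    have "coeff p (d - k - 1) = (\<Sum>j=1..<d. if j = k then c j * ?K j else 0)"
      unfolding p_def coeff_sum using k by (intro sum.cong) auto
    also have "\<dots> = c k * ?K k" using k by simp
    finally have "c k * ?K k = 0" using \<open>p = 0\<close> by simp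
    then show ?thesis
      using k sphere_area_pos[of k] sphere_area_pos[of "d - k"] sphere_area_pos[of d] by auto
  qed
  obtain t where "a < t" "t < b" using ab(2) dense by blast
  moreover have "(\<Sum>k=1..<d. c k * steiner_coeff d k t) = 0"
    using lt by (intro sum.neutral) auto
  ultimately have "c d = 0" using zero[of t] S[of t] by simp
  with lt k show ?thesis by (cases "k = d") auto
qed

section \<open>Parallel sets\<close>

text \<open>
  The pair of projections whose values the support measures record; its components are the two
  orthogonal parts in Moreau's decomposition of \<open>x\<close>.
\<close>

definition moreau_pair :: "'a::euclidean_space set \<Rightarrow> 'a \<Rightarrow> 'a \<times> 'a" where
  "moreau_pair C x = (closest_point C x, closest_point (dual_cone C) x)"

lemma moreau_pair_eq:
  "C \<in> convex_cones \<Longrightarrow> moreau_pair C x = (closest_point C x, x - closest_point C x)"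
  by (simp add: moreau_pair_def closest_point_dual_cone)

lemma local_parallel_set_eq:
  "local_parallel_set t C \<eta> = angular_nbhd t C \<inter> moreau_pair C -` \<eta>"
  by (auto simp: local_parallel_set_def angular_nbhd_def moreau_pair_def)

lemma borel_measurable_closest_point:
  assumes C: "C \<in> convex_cones"
  shows "closest_point C \<in> borel_measurable borel"
  by (intro borel_measurable_continuous_onI continuous_on_closest_point convex_cones_D[OF C])

lemma borel_measurable_moreau_pair:
  assumes C: "C \<in> convex_cones"
  shows "moreau_pair C \<in> borel_measurable borel"
proof -
  note [measurable] = borel_measurable_closest_point[OF C]
  have "(\<lambda>x. (closest_point C x, x - closest_point C x)) \<in> borel_measurable borel"
    by measurable
  then show ?thesis by (simp add: moreau_pair_eq[OF C] cong: measurable_cong)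
qed

lemma sets_angular_nbhd:
  assumes C: "C \<in> convex_cones" and t: "0 \<le> t" "t < pi / 2"
  shows "angular_nbhd t C \<in> sets borel"
proof -
  note [measurable] = borel_measurable_closest_point[OF C]
  have "angular_nbhd t C = {x \<in> space borel. x \<noteq> 0 \<and> cos t * norm x \<le> norm (closest_point C x)}"
    by (simp add: angular_nbhd_def angular_dist_le_iff[OF C t])
  also have "\<dots> \<in> sets borel" by measurable
  finally show ?thesis .
qed

lemma angular_nbhd_mono: "s \<le> t \<Longrightarrow> angular_nbhd s C \<subseteq> angular_nbhd t C"
  by (auto simp: angular_nbhd_def)

lemma UNIV_in_biconic_sets: "UNIV \<in> biconic_sets"
  by (simp add: biconic_sets_def)

lemma measurable_biconic:
  assumes "sets M = biconic_sets" and "g \<in> borel_measurable N"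
  shows "g \<in> measurable N M"
proof (rule measurableI)
  have sp: "space M = UNIV"
    using sets.space_closed[of M] UNIV_in_biconic_sets sets.sets_into_space assms(1) by blast
  show "g x \<in> space M" for x by (simp add: sp)
  show "g -` A \<inter> space N \<in> sets N" if "A \<in> sets M" for A
    using that assms by (intro measurable_sets[of g N borel]) (auto simp: biconic_sets_def)
qed

text \<open>
  The Steiner formula for all angles \<open>t \<in> T\<close>, combined with weights dual to its coefficients,
  isolates \<open>\<Omega> k\<close> as a signed combination of the image measures \<open>N t\<close> of the Gaussian measure on
  the parallel sets under \<open>moreau_pair C\<close>.
\<close>

lemma integral_support_measure:
  fixes C :: "'a::euclidean_space set"
  assumes C: "C \<in> convex_cones" and \<Omega>: "conic_support_measures C \<Omega>"
    and k: "k \<in> {1..DIM('a)}"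
    and T: "finite T" "T \<subseteq> {0..<pi / 2}"
    and dual: "\<And>i. i \<in> {1..DIM('a)} \<Longrightarrow>
      (\<Sum>t\<in>T. a t * steiner_coeff DIM('a) i t) = (if i = k then 1 else 0)"
    and h: "h \<in> borel_measurable (\<Omega> k)" and bound: "\<And>z. \<bar>h z\<bar> \<le> B"
  shows "integral\<^sup>L (\<Omega> k) h
    = (\<Sum>t\<in>T. a t * (\<integral>x. indicator (angular_nbhd t C) x * h (moreau_pair C x) \<partial>std_gaussian))"
proof -
  interpret prob_space "std_gaussian :: 'a measure" by (rule prob_space_std_gaussian)
  have sets_\<Omega>: "sets (\<Omega> k) = biconic_sets" and fin: "finite_measure (\<Omega> k)"
    using \<Omega> k by (auto simp: conic_support_measures_def)
  have steiner: "measure std_gaussian (local_parallel_set t C \<eta>)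
      = (\<Sum>i = 1..DIM('a). steiner_coeff DIM('a) i t * measure (\<Omega> i) \<eta>)"
    if "\<eta> \<in> biconic_sets" "t \<in> T" for \<eta> t
    using \<Omega> that T unfolding conic_support_measures_def by auto
  define R where "R t = restrict_space (std_gaussian :: 'a measure) (angular_nbhd t C)" for t
  define N where "N t = distr (R t) (\<Omega> k) (moreau_pair C)" for t
  have nb: "angular_nbhd t C \<in> sets std_gaussian" if "t \<in> T" for t
    using sets_angular_nbhd[OF C] that T by auto
  have mp: "moreau_pair C \<in> measurable (R t) (\<Omega> k)" for t
    unfolding R_def
    by (intro measurable_restrict_space1 measurable_biconic[OF sets_\<Omega>])
      (simp add: borel_measurable_moreau_pair[OF C] cong: measurable_cong_sets)
  have space_R: "space (R t) = angular_nbhd t C" for t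
    by (simp add: R_def space_restrict_space)
  have measure_N: "measure (N t) \<eta> = measure std_gaussian (local_parallel_set t C \<eta>)"
    if "t \<in> T" "\<eta> \<in> biconic_sets" for t \<eta>
  proof -
    have "measure (N t) \<eta> = measure (R t) (moreau_pair C -` \<eta> \<inter> space (R t))"
      unfolding N_def using that(2) sets_\<Omega> by (intro measure_distr mp) simp
    also have "\<dots> = measure std_gaussian (moreau_pair C -` \<eta> \<inter> angular_nbhd t C)"
      unfolding space_R unfolding R_def using nb[OF that(1)]
      by (intro measure_restrict_space) auto
    finally show ?thesis by (simp add: local_parallel_set_eq Int_commute)
  qed
  have "integral\<^sup>L (\<Omega> k) h = (\<Sum>t\<in>T. a t * integral\<^sup>L (N t) h)"
  proof (rule integral_eq_sum_integrals[OF fin _ _ _ h bound])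
    fix t assume t: "t \<in> T"
    show "finite_measure (N t)"
      unfolding N_def R_def
      by (intro finite_measure.finite_measure_distr finite_measure_restrict_space mp[unfolded R_def])
        (use nb[OF t] in auto)
    show "sets (N t) = sets (\<Omega> k)" by (simp add: N_def)
  next
    fix \<eta> assume "\<eta> \<in> sets (\<Omega> k)"
    then have \<eta>: "\<eta> \<in> biconic_sets" by (simp add: sets_\<Omega>)
    have "(\<Sum>t\<in>T. a t * measure (N t) \<eta>)
        = (\<Sum>t\<in>T. \<Sum>i = 1..DIM('a). a t * steiner_coeff DIM('a) i t * measure (\<Omega> i) \<eta>)"
      using \<eta> by (intro sum.cong) (auto simp: measure_N steiner sum_distrib_left mult.assoc)
    also have "\<dots> = (\<Sum>i = 1..DIM('a). (\<Sum>t\<in>T. a t * steiner_coeff DIM('a) i t) * measure (\<Omega> i) \<eta>)"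
      by (subst sum.swap) (simp add: sum_distrib_right)
    also have "\<dots> = (\<Sum>i = 1..DIM('a). if i = k then measure (\<Omega> i) \<eta> else 0)"
      by (intro sum.cong) (auto simp: dual)
    also have "\<dots> = measure (\<Omega> k) \<eta>" using k by simp
    finally show "measure (\<Omega> k) \<eta> = (\<Sum>t\<in>T. a t * measure (N t) \<eta>)" by simp
  qed
  also have "\<dots> = (\<Sum>t\<in>T. a t * (\<integral>x. indicator (angular_nbhd t C) x * h (moreau_pair C x) \<partial>std_gaussian))"
  proof (intro sum.cong refl arg_cong2[where f="(*)"])
    fix t assume t: "t \<in> T"
    have "integral\<^sup>L (N t) h = integral\<^sup>L (R t) (\<lambda>x. h (moreau_pair C x))"
      unfolding N_def by (rule integral_distr[OF mp h])
    also have "\<dots> = (\<integral>x. indicator (angular_nbhd t C) x * h (moreau_pair C x) \<partial>std_gaussian)"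
      unfolding R_def using nb[OF t]
      by (subst integral_restrict_space) (auto simp: set_lebesgue_integral_def)
    finally show "integral\<^sup>L (N t) h
        = (\<integral>x. indicator (angular_nbhd t C) x * h (moreau_pair C x) \<partial>std_gaussian)" .
  qed
  finally show ?thesis .
qed

text \<open>
  Independence of the coefficients, transported to the basis by a bijection with \<open>{1..d}\<close>. That
  neither the angles nor the weights depend on a cone makes all later constants uniform.
\<close>

lemma steiner_dual_weights:
  assumes k: "k \<in> {1..DIM('a::euclidean_space)}" and ab: "0 < a" "a < b" "b < pi / 2"
  obtains T w where "finite T" "T \<subseteq> {a<..<b}"
    "\<And>i. i \<in> {1..DIM('a)} \<Longrightarrow>
      (\<Sum>t\<in>T. w t * steiner_coeff DIM('a) i t) = (if i = k then 1 else 0)"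
proof -
  let ?d = "DIM('a)"
  obtain e :: "nat \<Rightarrow> 'a" where e: "bij_betw e {1..?d} Basis"
    using ex_bij_betw_nat_finite_1[OF finite_Basis] by blast
  define f where "f = inv_into {1..?d} e"
  have fe: "f (e i) = i" if "i \<in> {1..?d}" for i
    unfolding f_def using e that by (rule bij_betw_inv_into_left)
  have eB: "e i \<in> Basis" if "i \<in> {1..?d}" for i
    using bij_betwE[OF e] that by blast
  have eq_iff: "e i = e k \<longleftrightarrow> i = k" if "i \<in> {1..?d}" for i
    using e k that by (auto simp: bij_betw_def inj_on_eq_iff)
  obtain T w where T: "finite T" "T \<subseteq> {a<..<b}"
    "\<And>v. v \<in> Basis \<Longrightarrow> (\<Sum>t\<in>T. w t * steiner_coeff ?d (f v) t) = (if v = e k then 1 else 0)"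
  proof (rule dual_point_functionals[of "{a<..<b}" "\<lambda>v. steiner_coeff ?d (f v)" "e k"])
    fix c :: "'a \<Rightarrow> real"
    assume c: "\<And>t. t \<in> {a<..<b} \<Longrightarrow> (\<Sum>v\<in>Basis. c v * steiner_coeff ?d (f v) t) = 0"
    have "(\<Sum>i = 1..?d. c (e i) * steiner_coeff ?d i t) = 0" if "a < t" "t < b" for t
    proof -
      have "(\<Sum>i = 1..?d. c (e i) * steiner_coeff ?d i t)
          = (\<Sum>i = 1..?d. c (e i) * steiner_coeff ?d (f (e i)) t)"
        by (intro sum.cong) (auto simp: fe)
      also have "\<dots> = (\<Sum>v\<in>Basis. c v * steiner_coeff ?d (f v) t)"
        by (rule sum.reindex_bij_betw[OF e])
      finally show ?thesis using c that by simp
    qed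
    then have "c (e i) = 0" if "i \<in> {1..?d}" for i
      using steiner_coeff_independent[OF ab DIM_positive, of "\<lambda>i. c (e i)"] that by blast
    then show "\<forall>v\<in>Basis. c v = 0"
      using e by (metis bij_betw_imp_surj_on imageE)
  qed (use eB k in auto)
  show thesis
  proof (rule that[OF T(1,2), of w])
    fix i assume i: "i \<in> {1..?d}"
    show "(\<Sum>t\<in>T. w t * steiner_coeff ?d i t) = (if i = k then 1 else 0)"
      using T(3)[OF eB[OF i]] fe[OF i] eq_iff[OF i] by simp
  qed
qed

text \<open>
  The total masses are fixed combinations of Gaussian probabilities, hence bounded by the sum of the
  absolute values of the weights, uniformly in the cone.
\<close>

lemma support_measure_bounded:
  obtains A where
    "\<And>(C :: 'a::euclidean_space set) \<Omega> k. C \<in> convex_cones \<Longrightarrow> conic_support_measures C \<Omega> \<Longrightarrow>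
      k \<in> {1..DIM('a)} \<Longrightarrow> measure (\<Omega> k) UNIV \<le> A"
proof -
  interpret prob_space "std_gaussian :: 'a measure" by (rule prob_space_std_gaussian)
  have "\<exists>A. \<forall>(C :: 'a set) \<Omega>. C \<in> convex_cones \<longrightarrow> conic_support_measures C \<Omega> \<longrightarrow>
      measure (\<Omega> k) UNIV \<le> A" if k: "k \<in> {1..DIM('a)}" for k
  proof -
    obtain T w where T: "finite T" "T \<subseteq> {1/4<..<1/2::real}"
      "\<And>i. i \<in> {1..DIM('a)} \<Longrightarrow>
        (\<Sum>t\<in>T. w t * steiner_coeff DIM('a) i t) = (if i = k then 1 else 0)"
      using steiner_dual_weights[OF k, of "1/4" "1/2"] pi_gt3 by auto
    have T': "T \<subseteq> {0..<pi / 2}" using T(2) pi_gt3 by auto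
    have "measure (\<Omega> k) UNIV \<le> (\<Sum>t\<in>T. \<bar>w t\<bar>)"
      if C: "C \<in> convex_cones" and \<Omega>: "conic_support_measures C \<Omega>" for C :: "'a set" and \<Omega>
    proof -
      have sets_\<Omega>: "sets (\<Omega> k) = biconic_sets"
        using \<Omega> k by (auto simp: conic_support_measures_def)
      then have sp: "space (\<Omega> k) = UNIV"
        using UNIV_in_biconic_sets sets.sets_into_space by blast
      have "measure (\<Omega> k) UNIV = integral\<^sup>L (\<Omega> k) (\<lambda>_. 1)"
        by (simp add: sp)
      also have "\<dots> = (\<Sum>t\<in>T. w t * (\<integral>x. indicator (angular_nbhd t C) x * 1 \<partial>std_gaussian))"
        by (rule integral_support_measure[OF C \<Omega> k T(1) T' T(3), of _ 1]) auto
      also have "\<dots> = (\<Sum>t\<in>T. w t * prob (angular_nbhd t C))"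
        by simp
      also have "\<dots> \<le> (\<Sum>t\<in>T. \<bar>w t\<bar>)"
      proof (rule sum_mono)
        fix t
        have "w t * prob (angular_nbhd t C) \<le> \<bar>w t\<bar> * prob (angular_nbhd t C)"
          by (intro mult_right_mono) auto
        also have "\<dots> \<le> \<bar>w t\<bar>"
          by (simp add: mult_left_le)
        finally show "w t * prob (angular_nbhd t C) \<le> \<bar>w t\<bar>" .
      qed
      finally show ?thesis .
    qed
    then show ?thesis by blast
  qed
  then obtain A where A: "\<And>k (C :: 'a set) \<Omega>. k \<in> {1..DIM('a)} \<Longrightarrow> C \<in> convex_cones \<Longrightarrow>
      conic_support_measures C \<Omega> \<Longrightarrow> measure (\<Omega> k) UNIV \<le> A k"
    by metis
  show thesis
  proof (rule that[of "Max (A ` {1..DIM('a)})"])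
    fix C :: "'a set" and \<Omega> k
    assume *: "C \<in> convex_cones" "conic_support_measures C \<Omega>" "k \<in> {1..DIM('a)}"
    have "A k \<le> Max (A ` {1..DIM('a)})" using *(3) by (intro Max_ge) auto
    then show "measure (\<Omega> k) UNIV \<le> Max (A ` {1..DIM('a)})"
      using A[OF *(3,1,2)] by linarith
  qed
qed

text \<open>
  This is the total Steiner formula: the coefficients are Lipschitz in the angle and the total
  masses are bounded uniformly in the cone. The cone enters neither factor of the constant.
\<close>

lemma measure_angular_nbhd_Lipschitz:
  obtains K where "0 \<le> K"
    "\<And>(C :: 'a::euclidean_space set) \<Omega> s t. C \<in> convex_cones \<Longrightarrow> conic_support_measures C \<Omega> \<Longrightarrow>
      0 \<le> s \<Longrightarrow> s \<le> t \<Longrightarrow> t < pi / 2 \<Longrightarrow>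
      measure std_gaussian (angular_nbhd t C) - measure std_gaussian (angular_nbhd s C) \<le> K * (t - s)"
proof -
  let ?d = "DIM('a)"
  obtain A where A: "\<And>(C :: 'a set) \<Omega> k. C \<in> convex_cones \<Longrightarrow> conic_support_measures C \<Omega> \<Longrightarrow>
      k \<in> {1..?d} \<Longrightarrow> measure (\<Omega> k) UNIV \<le> A"
    by (rule support_measure_bounded) (use that in blast)
  define L where "L k = \<bar>sphere_area k * sphere_area (?d - k) / sphere_area ?d\<bar>" for k
  show thesis
  proof (rule that[of "(\<Sum>k = 1..?d. L k) * \<bar>A\<bar>"])
    show "0 \<le> (\<Sum>k = 1..?d. L k) * \<bar>A\<bar>"
      by (intro mult_nonneg_nonneg sum_nonneg) (auto simp: L_def)
    fix C :: "'a set" and \<Omega> and s t :: real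
    assume C: "C \<in> convex_cones" and \<Omega>: "conic_support_measures C \<Omega>"
      and st: "0 \<le> s" "s \<le> t" "t < pi / 2"
    have steiner: "measure std_gaussian (angular_nbhd r C)
        = (\<Sum>k = 1..?d. steiner_coeff ?d k r * measure (\<Omega> k) UNIV)" if "0 \<le> r" "r < pi / 2" for r
    proof -
      have "local_parallel_set r C UNIV = angular_nbhd r C"
        by (simp add: local_parallel_set_eq)
      then show ?thesis
        using \<Omega> that UNIV_in_biconic_sets unfolding conic_support_measures_def by metis
    qed
    have "measure std_gaussian (angular_nbhd t C) - measure std_gaussian (angular_nbhd s C)
        = (\<Sum>k = 1..?d. (steiner_coeff ?d k t - steiner_coeff ?d k s) * measure (\<Omega> k) UNIV)"
      using st by (simp add: steiner left_diff_distrib sum_subtractf)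
    also have "\<dots> \<le> (\<Sum>k = 1..?d. L k * (t - s) * \<bar>A\<bar>)"
    proof (rule sum_mono)
      fix k assume k: "k \<in> {1..?d}"
      have "\<bar>steiner_coeff ?d k t - steiner_coeff ?d k s\<bar> \<le> L k * (t - s)"
      proof (cases "k = ?d")
        case True
        then show ?thesis using st by (simp add: steiner_coeff_def L_def)
      next
        case False
        then show ?thesis
          unfolding L_def using k st by (intro steiner_coeff_Lipschitz) auto
      qed
      moreover have "measure (\<Omega> k) UNIV \<le> \<bar>A\<bar>"
        using A[OF C \<Omega> k] by linarith
      ultimately show "(steiner_coeff ?d k t - steiner_coeff ?d k s) * measure (\<Omega> k) UNIV
          \<le> L k * (t - s) * \<bar>A\<bar>"
        by (intro mult_mono) auto
    qed
    also have "\<dots> = (\<Sum>k = 1..?d. L k) * \<bar>A\<bar> * (t - s)"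
      by (simp add: sum_distrib_left sum_distrib_right mult_ac)
    finally show "measure std_gaussian (angular_nbhd t C) - measure std_gaussian (angular_nbhd s C)
        \<le> (\<Sum>k = 1..?d. L k) * \<bar>A\<bar> * (t - s)" .
  qed
qed

lemma angular_hausdorff_commute: "angular_hausdorff C D = angular_hausdorff D C"
  by (simp add: angular_hausdorff_def angular_hausdorff_bounds_def conj_commute)

text \<open>
  Points of the difference belong to the parallel set of \<open>D\<close> at angle \<open>t + \<delta>\<close> but not at
  angle \<open>t\<close>. The restriction \<open>t \<le> 1 / 2\<close> keeps \<open>t + \<delta> \<le> 3 / 2\<close> below \<open>pi / 2\<close>.
\<close>

lemma measure_angular_nbhd_Diff:
  fixes C D :: "'a::euclidean_space set"
  assumes C: "C \<in> convex_cones" and D: "D \<in> convex_cones"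
    and \<delta>: "angular_hausdorff C D \<le> 1" and t: "0 \<le> t" "t \<le> 1 / 2"
    and K: "\<And>s t. 0 \<le> s \<Longrightarrow> s \<le> t \<Longrightarrow> t < pi / 2 \<Longrightarrow>
      measure std_gaussian (angular_nbhd t D) - measure std_gaussian (angular_nbhd s D) \<le> K * (t - s)"
  shows "measure std_gaussian (angular_nbhd t C - angular_nbhd t D) \<le> K * angular_hausdorff C D"
proof -
  let ?\<delta> = "angular_hausdorff C D"
  interpret prob_space "std_gaussian :: 'a measure" by (rule prob_space_std_gaussian)
  note ah = angular_hausdorff_closest_point[OF C D \<delta>]
  have lt: "t + ?\<delta> < pi / 2" "t < pi / 2" "?\<delta> < pi / 2"
    using t \<delta> pi_gt3 by auto
  have ev: "angular_nbhd r D \<in> events" if "0 \<le> r" "r < pi / 2" for r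
    using sets_angular_nbhd[OF D that] by simp
  have "angular_nbhd t C \<subseteq> angular_nbhd (t + ?\<delta>) D"
    using ah(1,2) t lt by (intro angular_nbhd_subset[OF C D]) auto
  then have "prob (angular_nbhd t C - angular_nbhd t D)
      \<le> prob (angular_nbhd (t + ?\<delta>) D - angular_nbhd t D)"
    using ah(1) t lt by (intro finite_measure_mono sets.Diff ev) auto
  also have "\<dots> = prob (angular_nbhd (t + ?\<delta>) D) - prob (angular_nbhd t D)"
    using ah(1) t lt by (intro finite_measure_Diff ev angular_nbhd_mono) auto
  also have "\<dots> \<le> K * ?\<delta>"
    using K[of t "t + ?\<delta>"] ah(1) t lt by simp
  finally show ?thesis .
qed

section \<open>Test functions\<close>

lemma norm_normalize_diff_le:
  fixes p q :: "'a::real_normed_vector"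
  assumes "p \<noteq> 0" "q \<noteq> 0"
  shows "norm (p /\<^sub>R norm p - q /\<^sub>R norm q) \<le> 2 * norm (p - q) / norm p"
proof -
  have eq: "p /\<^sub>R norm p - q /\<^sub>R norm q
      = (p - q) /\<^sub>R norm p + (1 / norm p - 1 / norm q) *\<^sub>R q"
    by (simp add: algebra_simps inverse_eq_divide)
  have "norm ((1 / norm p - 1 / norm q) *\<^sub>R q) = \<bar>(1 / norm p - 1 / norm q) * norm q\<bar>"
    by (simp add: abs_mult)
  also have "(1 / norm p - 1 / norm q) * norm q = (norm q - norm p) / norm p"
    using assms by (simp add: field_simps)
  also have "\<bar>(norm q - norm p) / norm p\<bar> \<le> norm (p - q) / norm p"
    by (simp add: divide_right_mono norm_triangle_ineq3 norm_minus_commute[of p q])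
  finally have "norm ((1 / norm p - 1 / norm q) *\<^sub>R q) \<le> norm (p - q) / norm p" .
  then have "norm (p /\<^sub>R norm p - q /\<^sub>R norm q) \<le> norm (p - q) / norm p + norm (p - q) / norm p"
    unfolding eq by (intro norm_triangle_le) (simp add: divide_inverse mult.commute)
  then show ?thesis by simp
qed

lemma abs_homogeneous_ext_le_1:
  assumes "f \<in> bounded_lipschitz_functions"
  shows "\<bar>homogeneous_ext f z\<bar> \<le> 1"
proof (cases z)
  case (Pair x y)
  have "x \<noteq> 0 \<Longrightarrow> y \<noteq> 0 \<Longrightarrow> (x /\<^sub>R norm x, y /\<^sub>R norm y) \<in> sphere 0 1 \<times> sphere 0 1"
    by simp
  then show ?thesis
    using assms unfolding bounded_lipschitz_functions_def homogeneous_ext_def Pair by auto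
qed

lemma homogeneous_ext_diff_le:
  assumes f: "f \<in> bounded_lipschitz_functions" and m: "0 < m" and r: "0 < r"
    and p: "m * r \<le> norm p" "m * r \<le> norm q" "norm (p - q) \<le> e * r"
    and p': "m * r \<le> norm p'" "m * r \<le> norm q'" "norm (p' - q') \<le> e * r"
  shows "\<bar>homogeneous_ext f (p, p') - homogeneous_ext f (q, q')\<bar> \<le> 4 * e / m"
proof -
  \<comment> \<open>Each entry moves by at most \<open>2 e / m\<close> under normalization; both together give \<open>4 e / m\<close>.\<close>
  have normalize: "norm (u /\<^sub>R norm u - v /\<^sub>R norm v) \<le> 2 * e / m"
    if "m * r \<le> norm u" "m * r \<le> norm v" "norm (u - v) \<le> e * r" "u \<noteq> 0" "v \<noteq> 0" for u v :: 'a
  proof -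
    have mr: "0 < m * r" using m r by simp
    have "norm (u /\<^sub>R norm u - v /\<^sub>R norm v) \<le> 2 * norm (u - v) / norm u"
      using that by (intro norm_normalize_diff_le)
    also have "\<dots> \<le> 2 * (e * r) / (m * r)"
      using that mr by (intro frac_le mult_left_mono) (auto intro: order_trans[OF norm_ge_zero])
    finally show ?thesis using r by simp
  qed
  have nz: "p \<noteq> 0" "q \<noteq> 0" "p' \<noteq> 0" "q' \<noteq> 0"
    using mult_pos_pos[OF m r] p p' by auto
  let ?a = "(p /\<^sub>R norm p, p' /\<^sub>R norm p')" and ?b = "(q /\<^sub>R norm q, q' /\<^sub>R norm q')"
  have "dist (f ?a) (f ?b) \<le> 1 * dist ?a ?b"
    by (rule lipschitz_onD[of _ "sphere 0 1 \<times> sphere 0 1"])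
      (use f nz in \<open>auto simp: bounded_lipschitz_functions_def\<close>)
  also have "dist ?a ?b \<le> norm (p /\<^sub>R norm p - q /\<^sub>R norm q) + norm (p' /\<^sub>R norm p' - q' /\<^sub>R norm q')"
    unfolding dist_norm minus_prod_def fst_conv snd_conv by (rule norm_Pair_le)
  also have "\<dots> \<le> 2 * e / m + 2 * e / m"
    using nz by (intro add_mono normalize p p')
  finally show ?thesis using nz by (simp add: homogeneous_ext_def dist_real_def)
qed

text \<open>
  On pairs of nonzero vectors the extension is a continuous function of the normalized pair, and
  elsewhere it is zero, so it is Borel. Its invariance under independent positive scalings of the two
  entries makes the preimages biconic.
\<close>

lemma measurable_homogeneous_ext:
  fixes f :: "'a::euclidean_space \<times> 'a \<Rightarrow> real"
  assumes f: "f \<in> bounded_lipschitz_functions"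
  shows "homogeneous_ext f \<in> borel_measurable borel"
    and "sets M = biconic_sets \<Longrightarrow> homogeneous_ext f \<in> borel_measurable M"
proof -
  let ?U = "{z :: 'a \<times> 'a. fst z \<noteq> 0} \<inter> {z. snd z \<noteq> 0}"
  let ?n = "\<lambda>z. (fst z /\<^sub>R norm (fst z), snd z /\<^sub>R norm (snd z))"
  have "open ?U"
    by (intro open_Int open_Collect_neq continuous_intros)
  moreover have "continuous_on ?U (f \<circ> ?n)"
  proof (rule continuous_on_compose)
    show "continuous_on ?U ?n" by (intro continuous_intros) auto
    have "continuous_on (sphere 0 1 \<times> sphere 0 1) f"
      using f by (auto simp: bounded_lipschitz_functions_def intro: lipschitz_on_continuous_on)
    then show "continuous_on (?n ` ?U) f"
      by (rule continuous_on_subset) auto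
  qed
  ultimately have "(\<lambda>z. indicator ?U z *\<^sub>R (f \<circ> ?n) z) \<in> borel_measurable borel"
    by (intro borel_measurable_continuous_on_indicator) auto
  moreover have "(\<lambda>z. indicator ?U z *\<^sub>R (f \<circ> ?n) z) = homogeneous_ext f"
    by (auto simp: fun_eq_iff homogeneous_ext_def)
  ultimately show borel: "homogeneous_ext f \<in> borel_measurable borel" by simp
  show "homogeneous_ext f \<in> borel_measurable M" if M: "sets M = biconic_sets"
  proof (rule measurableI)
    fix A :: "real set" assume A: "A \<in> sets borel"
    have normalize: "(r *\<^sub>R x) /\<^sub>R norm (r *\<^sub>R x) = x /\<^sub>R norm x" if "0 < r" for r :: real and x :: 'a
      using that by (simp add: field_simps)
    have "homogeneous_ext f -` A \<in> sets borel"
      using measurable_sets[OF borel A] by simp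
    moreover have "homogeneous_ext f (r *\<^sub>R x, s *\<^sub>R y) = homogeneous_ext f (x, y)"
      if "0 < r" "0 < s" for r s :: real and x y
      using that by (simp add: homogeneous_ext_def normalize del: norm_scaleR scaleR_scaleR)
    ultimately have "homogeneous_ext f -` A \<in> biconic_sets"
      by (simp add: biconic_sets_def)
    moreover have "space M = UNIV"
      using M UNIV_in_biconic_sets sets.sets_into_space by blast
    ultimately show "homogeneous_ext f -` A \<inter> space M \<in> sets M" by (simp add: M)
  qed simp
qed

section \<open>Stability of the shell integrals and of the support measures\<close>

text \<open>
  For \<open>s > 0\<close> the angle between a point \<open>x\<close> of the shell and \<open>C\<close> stays away from both \<open>0\<close> and
  \<open>pi / 2\<close>, so neither projection can be short. This is what makes the homogeneous extensions Lipschitz there.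
\<close>

lemma shell_projections_ge:
  assumes C: "C \<in> convex_cones" and s: "0 \<le> s" "s \<le> t" "t < pi / 2"
    and x: "x \<in> angular_nbhd t C" "x \<notin> angular_nbhd s C"
  shows "x \<noteq> 0" "cos t * norm x \<le> norm (closest_point C x)"
    and "sin s * norm x \<le> norm (x - closest_point C x)"
proof -
  show x0: "x \<noteq> 0" and "cos t * norm x \<le> norm (closest_point C x)"
    using x(1) s angular_dist_le_iff[OF C, of t x] by (auto simp: angular_nbhd_def)
  have "norm (closest_point C x) \<le> cos s * norm x"
    using x(2) x0 s angular_dist_le_iff[OF C, of s x] by (auto simp: angular_nbhd_def)
  then have "(norm (closest_point C x))\<^sup>2 \<le> (cos s * norm x)\<^sup>2"
    by (intro power_mono) auto
  then have "(sin s * norm x)\<^sup>2 \<le> (norm (x - closest_point C x))\<^sup>2"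
    using norm_closest_point_cone(1)[OF C, of x]
    by (simp add: power_mult_distrib sin_squared_eq algebra_simps)
  then show "sin s * norm x \<le> norm (x - closest_point C x)"
    by (rule power2_le_imp_le) simp
qed

lemma homogeneous_ext_moreau_pair_diff_le:
  assumes C: "C \<in> convex_cones" and D: "D \<in> convex_cones"
    and \<delta>: "angular_hausdorff C D \<le> 1" and f: "f \<in> bounded_lipschitz_functions"
    and s: "0 < s" "s \<le> t" "t < pi / 2"
    and x: "x \<in> angular_nbhd t C" "x \<notin> angular_nbhd s C" "x \<in> angular_nbhd t D" "x \<notin> angular_nbhd s D"
  shows "\<bar>homogeneous_ext f (moreau_pair C x) - homogeneous_ext f (moreau_pair D x)\<bar>
    \<le> 4 * sqrt 2 / min (cos t) (sin s) * sqrt (angular_hausdorff C D)"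
proof -
  let ?m = "min (cos t) (sin s)" and ?e = "sqrt (2 * angular_hausdorff C D)"
  have m: "0 < ?m"
    using s by (simp add: cos_gt_zero_pi sin_gt_zero)
  have le: "?m * norm x \<le> cos t * norm x" "?m * norm x \<le> sin s * norm x"
    by (intro mult_right_mono; simp)+
  note shC = shell_projections_ge[OF C _ s(2,3) x(1,2)]
  note shD = shell_projections_ge[OF D _ s(2,3) x(3,4)]
  note diff = norm_diff_closest_points_le[OF C D \<delta>, of x]
  have diff': "norm ((x - closest_point C x) - (x - closest_point D x)) \<le> ?e * norm x"
    using diff by (simp add: norm_minus_commute)
  have "\<bar>homogeneous_ext f (moreau_pair C x) - homogeneous_ext f (moreau_pair D x)\<bar> \<le> 4 * ?e / ?m"
    unfolding moreau_pair_eq[OF C] moreau_pair_eq[OF D]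
  proof (rule homogeneous_ext_diff_le[OF f m _ _ _ diff _ _ diff'])
    show "0 < norm x" using shC(1) s by simp
  qed (use le shC(2,3) shD(2,3) s in linarith)+
  then show ?thesis
    by (simp add: real_sqrt_mult)
qed

text \<open>
  Outside the symmetric differences of the inner and of the outer parallel sets, \<open>x\<close> lies in the
  shells of both cones or in neither, and the integrands differ by \<open>O(\<delta>\<^sup>1\<^sup>/\<^sup>2)\<close> because the
  projections do. On the symmetric differences the integrands differ by at most \<open>2\<close>, and each
  of these two sets has measure at most \<open>2 K \<delta>\<close>.
\<close>

lemma shell_integral_diff_le:
  fixes C D :: "'a::euclidean_space set"
  assumes C: "C \<in> convex_cones" and D: "D \<in> convex_cones"
    and \<delta>: "angular_hausdorff C D \<le> 1" and f: "f \<in> bounded_lipschitz_functions"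
    and s: "0 < s" "s \<le> t" "t \<le> 1 / 2"
    and K: "\<And>E s t. E \<in> {C, D} \<Longrightarrow> 0 \<le> s \<Longrightarrow> s \<le> t \<Longrightarrow> t < pi / 2 \<Longrightarrow>
      measure std_gaussian (angular_nbhd t E) - measure std_gaussian (angular_nbhd s E) \<le> K * (t - s)"
    and K0: "0 \<le> K"
  defines "I \<equiv> \<lambda>E r. \<integral>x. indicator (angular_nbhd r E) x * homogeneous_ext f (moreau_pair E x) \<partial>std_gaussian"
  shows "\<bar>(I C t - I C s) - (I D t - I D s)\<bar>
    \<le> (4 * sqrt 2 / min (cos (1 / 2)) (sin s) + 8 * K) * sqrt (angular_hausdorff C D)"
proof -
  let ?\<delta> = "angular_hausdorff C D"
  let ?L = "4 * sqrt 2 / min (cos (1 / 2)) (sin s)"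
  interpret prob_space "std_gaussian :: 'a measure" by (rule prob_space_std_gaussian)
  have lt: "s < pi / 2" "t < pi / 2" using s pi_gt3 by auto
  have \<delta>0: "0 \<le> ?\<delta>" by (rule angular_hausdorff_closest_point(1)[OF C D \<delta>])
  have ev: "angular_nbhd r E \<in> sets borel" if "E \<in> {C, D}" "r \<in> {s, t}" for E r
    using that C D s lt by (auto intro!: sets_angular_nbhd)
  define F where "F E x = homogeneous_ext f (moreau_pair E x)" for E x
  have F_meas: "F E \<in> borel_measurable borel" if "E \<in> {C, D}" for E
    unfolding F_def using that C D
    by (intro measurable_compose[OF borel_measurable_moreau_pair measurable_homogeneous_ext(1)[OF f]]) auto
  have F1: "\<bar>F E x\<bar> \<le> 1" for E x
    unfolding F_def by (rule abs_homogeneous_ext_le_1[OF f])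
  have int: "integrable std_gaussian (\<lambda>x. indicator (angular_nbhd r E) x * F E x)"
    if "E \<in> {C, D}" "r \<in> {s, t}" for E r
  proof (rule integrable_const_bound[of _ 1])
    show "AE x in std_gaussian. norm (indicator (angular_nbhd r E) x * F E x) \<le> 1"
      using F1 by (intro AE_I2) (simp add: indicator_def)
    show "(\<lambda>x. indicator (angular_nbhd r E) x * F E x) \<in> borel_measurable std_gaussian"
      using ev[OF that] F_meas[OF that(1)] by measurable
  qed
  define u where "u E x = indicator (angular_nbhd t E) x * F E x - indicator (angular_nbhd s E) x * F E x"
    for E x
  define S where "S r = (angular_nbhd r C - angular_nbhd r D) \<union> (angular_nbhd r D - angular_nbhd r C)" for r
  have u_int: "integrable std_gaussian (u E)" if "E \<in> {C, D}" for E
    unfolding u_def using int that by (intro Bochner_Integration.integrable_diff) auto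
  have I_diff: "I E t - I E s = integral\<^sup>L std_gaussian (u E)" if "E \<in> {C, D}" for E
    unfolding I_def u_def F_def[symmetric] using int that
    by (intro Bochner_Integration.integral_diff[symmetric]) auto
  have S_ev: "S r \<in> events" if "r \<in> {s, t}" for r
    unfolding S_def using ev that by auto
  have prob_S: "prob (S r) \<le> 2 * K * ?\<delta>" if "r \<in> {s, t}" for r
  proof -
    have r: "0 \<le> r" "r \<le> 1 / 2" using that s by auto
    have "prob (S r) \<le> prob (angular_nbhd r C - angular_nbhd r D) + prob (angular_nbhd r D - angular_nbhd r C)"
      unfolding S_def using ev that by (intro measure_Un_le) auto
    also have "prob (angular_nbhd r C - angular_nbhd r D) \<le> K * ?\<delta>"
      using K by (intro measure_angular_nbhd_Diff C D \<delta> r) auto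
    also have "prob (angular_nbhd r D - angular_nbhd r C) \<le> K * ?\<delta>"
      unfolding angular_hausdorff_commute[of C D]
      using K \<delta> by (intro measure_angular_nbhd_Diff C D r) (auto simp: angular_hausdorff_commute)
    finally show ?thesis by simp
  qed
  have pw: "\<bar>u C x - u D x\<bar> \<le> ?L * sqrt ?\<delta> + 2 * indicator (S t) x + 2 * indicator (S s) x" for x
  proof (cases "x \<in> S t \<or> x \<in> S s")
    case True
    have u1: "\<bar>u E x\<bar> \<le> 1" for E
    proof -
      have "u E x = indicator (angular_nbhd t E - angular_nbhd s E) x * F E x"
        using angular_nbhd_mono[OF s(2), of E] by (auto simp: u_def indicator_def)
      then show ?thesis using F1[of E x] by (simp add: indicator_def)
    qed
    have "0 < cos (1/2::real)" "0 < sin s"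
      using s lt pi_gt3 by (auto intro!: cos_gt_zero_pi sin_gt_zero)
    then have "0 \<le> ?L * sqrt ?\<delta>"
      using \<delta>0 by (intro mult_nonneg_nonneg divide_nonneg_nonneg) auto
    moreover have "\<bar>u C x - u D x\<bar> \<le> 2" using u1[of C] u1[of D] by linarith
    moreover have "1 \<le> indicator (S t) x + (indicator (S s) x :: real)"
      using True by (auto simp: indicator_def)
    ultimately show ?thesis by linarith
  next
    case False
    then have same: "x \<in> angular_nbhd r C \<longleftrightarrow> x \<in> angular_nbhd r D" if "r \<in> {s, t}" for r
      using that by (auto simp: S_def)
    have "min (cos (1/2)) (sin s) \<le> min (cos t) (sin s)"
      using s pi_gt3 by (intro min.mono cos_monotone_0_pi_le) auto
    moreover have m0: "0 < min (cos (1/2)) (sin s)"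
      using s lt pi_gt3 by (auto intro!: cos_gt_zero_pi sin_gt_zero)
    ultimately have L: "4 * sqrt 2 / min (cos t) (sin s) \<le> ?L"
      by (intro divide_left_mono mult_pos_pos) auto
    have L0: "0 \<le> ?L" using m0 by (intro divide_nonneg_nonneg) auto
    show ?thesis
    proof (cases "x \<in> angular_nbhd t C - angular_nbhd s C")
      case True
      then have "\<bar>u C x - u D x\<bar> \<le> 4 * sqrt 2 / min (cos t) (sin s) * sqrt ?\<delta>"
        using homogeneous_ext_moreau_pair_diff_le[OF C D \<delta> f s(1,2) lt(2), of x] same
        by (simp add: u_def F_def)
      also have "\<dots> \<le> ?L * sqrt ?\<delta>"
        using \<delta>0 by (intro mult_right_mono L) auto
      finally show ?thesis using False by simp
    next
      case False
      then have "u C x = 0" "u D x = 0"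
        using same angular_nbhd_mono[OF s(2), of C] angular_nbhd_mono[OF s(2), of D]
        by (auto simp: u_def indicator_def)
      then have "\<bar>u C x - u D x\<bar> = 0" by simp
      moreover have "0 \<le> ?L * sqrt ?\<delta>"
        using L0 \<delta>0 by (intro mult_nonneg_nonneg) auto
      moreover have "0 \<le> (indicator (S t) x :: real)" "0 \<le> (indicator (S s) x :: real)"
        by simp_all
      ultimately show ?thesis by linarith
    qed
  qed
  have Sint: "integrable std_gaussian (\<lambda>x. indicator (S r) x :: real)" if "r \<in> {s, t}" for r
    using S_ev[OF that] by (simp add: less_top[symmetric])
  have "\<bar>(I C t - I C s) - (I D t - I D s)\<bar> = \<bar>\<integral>x. u C x - u D x \<partial>std_gaussian\<bar>"
    using u_int by (simp add: I_diff Bochner_Integration.integral_diff)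
  also have "\<dots> \<le> (\<integral>x. \<bar>u C x - u D x\<bar> \<partial>std_gaussian)"
    by (rule integral_abs_bound)
  also have "\<dots> \<le> (\<integral>x. ?L * sqrt ?\<delta> + 2 * indicator (S t) x + 2 * indicator (S s) x \<partial>std_gaussian)"
    using u_int Sint
    by (intro integral_mono pw integrable_abs Bochner_Integration.integrable_add
        Bochner_Integration.integrable_diff integrable_mult_right integrable_const) auto
  also have "\<dots> = ?L * sqrt ?\<delta> + 2 * prob (S t) + 2 * prob (S s)"
    using Sint S_ev by (simp add: prob_space[unfolded space_std_gaussian])
  also have "\<dots> \<le> ?L * sqrt ?\<delta> + 8 * K * ?\<delta>"
    using prob_S[of t] prob_S[of s] by simp
  also have "\<dots> \<le> ?L * sqrt ?\<delta> + 8 * K * sqrt ?\<delta>"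
  proof -
    have "?\<delta> \<le> sqrt ?\<delta>"
      using \<delta>0 \<delta> by (intro real_le_rsqrt) (simp add: power2_eq_square mult_left_le)
    then show ?thesis using K0 by (intro add_left_mono mult_left_mono) auto
  qed
  finally show ?thesis by (simp add: ring_distribs)
qed

text \<open>
  The Steiner coefficient of index \<open>d\<close> is constantly \<open>1\<close>, so the duality relation for \<open>i = d\<close> says
  that the weights for \<open>k < d\<close> sum to zero. The integrals over the parallel sets at angle \<open>t\<close> can
  therefore be replaced by integrals over the shells between the angles \<open>1 / 4\<close> and \<open>t\<close>.
\<close>

lemma dist_bL_conic_support_measures_le:
  assumes k: "k \<in> {1..DIM('a::euclidean_space) - 1}"
  obtains c where "0 \<le> c"
    "\<And>(C :: 'a set) D \<Omega>\<^sub>C \<Omega>\<^sub>D. C \<in> convex_cones \<Longrightarrow> D \<in> convex_cones \<Longrightarrow>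
      conic_support_measures C \<Omega>\<^sub>C \<Longrightarrow> conic_support_measures D \<Omega>\<^sub>D \<Longrightarrow>
      angular_hausdorff C D \<le> 1 \<Longrightarrow>
      dist_bL (\<Omega>\<^sub>C k) (\<Omega>\<^sub>D k) \<le> c * sqrt (angular_hausdorff C D)"
proof -
  let ?d = "DIM('a)" and ?s = "1 / 4 :: real"
  have "1 \<le> k" "k \<le> ?d - 1" using k by simp_all
  then have k': "k \<in> {1..?d}" "k \<noteq> ?d" unfolding atLeastAtMost_iff by linarith+
  obtain T w where T: "finite T" "T \<subseteq> {?s<..<1/2}"
    "\<And>i. i \<in> {1..?d} \<Longrightarrow> (\<Sum>t\<in>T. w t * steiner_coeff ?d i t) = (if i = k then 1 else 0)"
    using steiner_dual_weights[OF k'(1), of ?s "1/2"] pi_gt3 by auto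
  have T': "T \<subseteq> {0..<pi / 2}" using T(2) pi_gt3 by auto
  have sum0: "(\<Sum>t\<in>T. w t) = 0"
    using T(3)[of ?d] k'(2) by (simp add: steiner_coeff_def DIM_positive Suc_leI)
  obtain K where K: "0 \<le> K"
    "\<And>(C :: 'a set) \<Omega> s t. C \<in> convex_cones \<Longrightarrow> conic_support_measures C \<Omega> \<Longrightarrow>
      0 \<le> s \<Longrightarrow> s \<le> t \<Longrightarrow> t < pi / 2 \<Longrightarrow>
      measure std_gaussian (angular_nbhd t C) - measure std_gaussian (angular_nbhd s C) \<le> K * (t - s)"
    by (rule measure_angular_nbhd_Lipschitz) (use that in blast)
  define c where "c = 4 * sqrt 2 / min (cos (1 / 2)) (sin ?s) + 8 * K"
  have "0 < min (cos (1/2)) (sin ?s)"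
    using pi_gt3 by (auto intro!: cos_gt_zero_pi sin_gt_zero)
  then have c0: "0 \<le> c" using K(1) by (simp add: c_def)
  show thesis
  proof (rule that[of "(\<Sum>t\<in>T. \<bar>w t\<bar>) * c"])
    show "0 \<le> (\<Sum>t\<in>T. \<bar>w t\<bar>) * c" using c0 by (simp add: sum_nonneg)
    fix C D :: "'a set" and \<Omega>\<^sub>C \<Omega>\<^sub>D
    assume C: "C \<in> convex_cones" "conic_support_measures C \<Omega>\<^sub>C"
      and D: "D \<in> convex_cones" "conic_support_measures D \<Omega>\<^sub>D"
      and \<delta>: "angular_hausdorff C D \<le> 1"
    let ?\<delta> = "angular_hausdorff C D"
    have "\<bar>integral\<^sup>L (\<Omega>\<^sub>C k) (homogeneous_ext f) - integral\<^sup>L (\<Omega>\<^sub>D k) (homogeneous_ext f)\<bar>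
        \<le> (\<Sum>t\<in>T. \<bar>w t\<bar>) * c * sqrt ?\<delta>" if f: "f \<in> bounded_lipschitz_functions" for f
    proof -
      define I where "I E r = (\<integral>x. indicator (angular_nbhd r E) x * homogeneous_ext f (moreau_pair E x)
        \<partial>std_gaussian)" for E :: "'a set" and r
      have rep: "integral\<^sup>L (\<Omega> k) (homogeneous_ext f) = (\<Sum>t\<in>T. w t * (I E t - I E ?s))"
        if E: "E \<in> convex_cones" and \<Omega>: "conic_support_measures E \<Omega>" for E \<Omega>
      proof -
        have "sets (\<Omega> k) = biconic_sets"
          using \<Omega> k' by (auto simp: conic_support_measures_def)
        then have "integral\<^sup>L (\<Omega> k) (homogeneous_ext f) = (\<Sum>t\<in>T. w t * I E t)"
          unfolding I_def using f
          by (intro integral_support_measure[OF E \<Omega> k'(1) T(1) T' T(3), of _ 1]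
              measurable_homogeneous_ext abs_homogeneous_ext_le_1)
        also have "\<dots> = (\<Sum>t\<in>T. w t * I E t) - (\<Sum>t\<in>T. w t) * I E ?s"
          by (simp add: sum0)
        finally show ?thesis
          by (simp add: right_diff_distrib sum_subtractf sum_distrib_right)
      qed
      have "\<bar>integral\<^sup>L (\<Omega>\<^sub>C k) (homogeneous_ext f) - integral\<^sup>L (\<Omega>\<^sub>D k) (homogeneous_ext f)\<bar>
          = \<bar>\<Sum>t\<in>T. w t * ((I C t - I C ?s) - (I D t - I D ?s))\<bar>"
        unfolding rep[OF C] rep[OF D] sum_subtractf[symmetric] right_diff_distrib[symmetric] ..
      also have "\<dots> \<le> (\<Sum>t\<in>T. \<bar>w t\<bar> * (c * sqrt ?\<delta>))"
      proof (rule order_trans[OF sum_abs], rule sum_mono)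
        fix t assume t: "t \<in> T"
        have "\<bar>(I C t - I C ?s) - (I D t - I D ?s)\<bar> \<le> c * sqrt ?\<delta>"
          unfolding I_def c_def
          using C D K T(2) t by (intro shell_integral_diff_le \<delta> f) auto
        then show "\<bar>w t * ((I C t - I C ?s) - (I D t - I D ?s))\<bar> \<le> \<bar>w t\<bar> * (c * sqrt ?\<delta>)"
          unfolding abs_mult by (intro mult_left_mono) auto
      qed
      finally show ?thesis
        by (simp add: sum_distrib_right mult.assoc)
    qed
    \<comment> \<open>A supremum of reals is bounded by a common upper bound only over a nonempty set.\<close>
    moreover have "(\<lambda>_. 0) \<in> (bounded_lipschitz_functions :: ('a \<times> 'a \<Rightarrow> real) set)"
      by (simp add: bounded_lipschitz_functions_def lipschitz_on_def)
    ultimately show "dist_bL (\<Omega>\<^sub>C k) (\<Omega>\<^sub>D k) \<le> (\<Sum>t\<in>T. \<bar>w t\<bar>) * c * sqrt ?\<delta>"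
      unfolding dist_bL_def by (intro cSUP_least) auto
  qed
qed

theorem theorem4p1:
  assumes "CARD('n::finite) \<ge> 2"
  shows "\<exists>c::real. \<forall>(C::(real^'n) set) D \<Omega>\<^sub>C \<Omega>\<^sub>D.
           C \<in> convex_cones \<longrightarrow> D \<in> convex_cones \<longrightarrow>
           conic_support_measures C \<Omega>\<^sub>C \<longrightarrow> conic_support_measures D \<Omega>\<^sub>D \<longrightarrow>
           angular_hausdorff C D \<le> 1 \<longrightarrow>
           (\<forall>k\<in>{1..CARD('n) - 1}.
              dist_bL (\<Omega>\<^sub>C k) (\<Omega>\<^sub>D k) \<le> c * sqrt (angular_hausdorff C D))"
proof -
  let ?K = "{1..CARD('n) - 1}"
  have "\<exists>c\<ge>0. \<forall>(C::(real^'n) set) D \<Omega>\<^sub>C \<Omega>\<^sub>D. C \<in> convex_cones \<longrightarrow> D \<in> convex_cones \<longrightarrow>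
      conic_support_measures C \<Omega>\<^sub>C \<longrightarrow> conic_support_measures D \<Omega>\<^sub>D \<longrightarrow>
      angular_hausdorff C D \<le> 1 \<longrightarrow>
      dist_bL (\<Omega>\<^sub>C k) (\<Omega>\<^sub>D k) \<le> c * sqrt (angular_hausdorff C D)" if "k \<in> ?K" for k
  proof -
    have "k \<in> {1..DIM(real^'n) - 1}" using that by simp
    then show ?thesis
      by (rule dist_bL_conic_support_measures_le) blast
  qed
  then obtain c where c0: "\<And>k. k \<in> ?K \<Longrightarrow> 0 \<le> c k" and c: "\<And>k (C::(real^'n) set) D \<Omega>\<^sub>C \<Omega>\<^sub>D.
      k \<in> ?K \<Longrightarrow> C \<in> convex_cones \<Longrightarrow> D \<in> convex_cones \<Longrightarrow>
      conic_support_measures C \<Omega>\<^sub>C \<Longrightarrow> conic_support_measures D \<Omega>\<^sub>D \<Longrightarrow>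
      angular_hausdorff C D \<le> 1 \<Longrightarrow>
      dist_bL (\<Omega>\<^sub>C k) (\<Omega>\<^sub>D k) \<le> c k * sqrt (angular_hausdorff C D)"
    by metis
  show ?thesis
  proof (intro exI[of _ "\<Sum>k\<in>?K. c k"] allI impI ballI)
    fix C D :: "(real^'n) set" and \<Omega>\<^sub>C \<Omega>\<^sub>D k
    assume C: "C \<in> convex_cones" and D: "D \<in> convex_cones"
      and \<Omega>: "conic_support_measures C \<Omega>\<^sub>C" "conic_support_measures D \<Omega>\<^sub>D"
      and \<delta>: "angular_hausdorff C D \<le> 1" and k: "k \<in> ?K"
    have "dist_bL (\<Omega>\<^sub>C k) (\<Omega>\<^sub>D k) \<le> c k * sqrt (angular_hausdorff C D)"
      by (rule c[OF k C D \<Omega> \<delta>])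
    also have "\<dots> \<le> (\<Sum>k\<in>?K. c k) * sqrt (angular_hausdorff C D)"
      using angular_hausdorff_closest_point(1)[OF C D \<delta>] c0 k
      by (intro mult_right_mono member_le_sum) auto
    finally show "dist_bL (\<Omega>\<^sub>C k) (\<Omega>\<^sub>D k) \<le> (\<Sum>k\<in>?K. c k) * sqrt (angular_hausdorff C D)" .
  qed
qed

end
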